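(* Let $\mathcal{N}$ be an irreducible sorting network with $n$ levels and let $\Lambda$ be a pseudoline arrangement supported by $\mathcal{N}$. The cone of the brick polytope $\Omega(\mathcal{N})$ at the brick vector $\omega(\Lambda)$ is precisely the incidence cone $C(\Lambda^\#)$ of the contact graph of $\Lambda$: $$\mathrm{cone}\{\omega(\Lambda')-\omega(\Lambda):\Lambda'\in\mathrm{arr}(\mathcal{N})\}=\mathrm{cone}\{e_j-e_i:(i,j)\in\Lambda^\#\}.$$
   Context: A network $\mathcal{N}$ with $n$ levels and $m$ commutators consists of $n$ horizontal lines (levels), labeled $1,\dots,n$ from bottom to top, together with $m$ vertical segments (commutators), each joining two consecutive levels, such that no two commutators share an endpoint. The bricks of $\mathcal{N}$ are its bounded cells. A pseudoline is an abscissa-monotone path in $\mathcal{N}$. A contact between two pseudolines is a commutator whose two endpoints lie one on each pseudoline; a crossing is a commutator traversed by both. A pseudoline arrangement supported by $\mathcal{N}$ is a set of $n$ pseudolines on $\mathcal{N}$ such that any two have exactly one crossing, possibly some contacts, and no other intersection; its $i$-th pseudoline starts at level $i$ on the left. $\mathcal{N}$ is sorting if it supports at least one arrangement; $\mathrm{arr}(\mathcal{N})$ is the set of these. The brick vector $\omega(\Lambda)\in\mathbb{R}^n$ has $i$-th coordinate the number of bricks below the $i$-th pseudoline of $\Lambda$; $\Omega(\mathcal{N})=\mathrm{conv}\{\omega(\Lambda):\Lambda\in\mathrm{arr}(\mathcal{N})\}$. The contact graph $\Lambda^\#$ is the directed multigraph on $[n]$ (vertex $i$ = $i$-th pseudoline)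 with one arc per contact of $\Lambda$, oriented from the pseudoline passing above the contact to the one passing below it. $\mathcal{N}$ is irreducible if the contact graphs of the arrangements it supports are connected as undirected graphs. $e_1,\dots,e_n$ is the canonical basis of $\mathbb{R}^n$ and $\mathrm{cone}$ denotes the positive span. *)

theory Defs
  imports "Graph_Theory.Digraph_Component" "HOL-Analysis.Analysis"
begin

text \<open>
  The levels \<open>1, \<dots>, n\<close> are the elements of a finite linearly ordered type \<open>'n\<close>, listed from
  bottom to top by its order.  A commutator joining the levels \<open>a < b\<close> is the pair \<open>(a, b)\<close>, and a
  network is the list of its commutators read from left to right.  Listing them at distinct
  abscissae is no restriction: commutators on a common vertical line have no endpoint in common,
  so they may be moved apart slightly and listed in any order, without changing any of the notions
  below. Distinct list positions thus never share an endpoint.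
\<close>

type_synonym 'n commutator = "'n \<times> 'n"

definition network :: "('n::{finite,linorder}) commutator list \<Rightarrow> bool" where
  "network N \<longleftrightarrow> (\<forall>(a, b) \<in> set N. a < b \<and> {a<..<b} = {})"

text \<open>
  A brick lies between two consecutive commutators, at positions \<open>s < t\<close>, that join the same two
  levels.  The leftmost and rightmost cells between two levels are unbounded.
\<close>

definition bricks :: "'n commutator list \<Rightarrow> (nat \<times> nat) set" where
  "bricks N = {(s, t). s < t \<and> t < length N \<and> N ! s = N ! t \<and>
     (\<forall>u. s < u \<and> u < t \<longrightarrow> N ! u \<noteq> N ! s)}"

text \<open>
  The \<open>m\<close> commutators cut the abscissa axis into \<open>m + 1\<close> intervals.  A path \<open>p\<close> is the list of the
  levels it follows on them: \<open>p ! t\<close> and \<open>p ! Suc t\<close> are its levels just before and just after the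
  commutator at position \<open>t\<close>.
\<close>

definition traverses :: "'n commutator list \<Rightarrow> 'n list \<Rightarrow> nat \<Rightarrow> bool" where
  "traverses N p t \<longleftrightarrow> {p ! t, p ! Suc t} = {fst (N ! t), snd (N ! t)}"

definition pseudoline :: "'n commutator list \<Rightarrow> 'n list \<Rightarrow> bool" where
  "pseudoline N p \<longleftrightarrow> length p = Suc (length N) \<and>
     (\<forall>t < length N. p ! Suc t = p ! t \<or> traverses N p t)"

definition crossing :: "'n commutator list \<Rightarrow> 'n list \<Rightarrow> 'n list \<Rightarrow> nat \<Rightarrow> bool" where
  "crossing N p q t \<longleftrightarrow> t < length N \<and> traverses N p t \<and> traverses N q t"

text \<open>A contact at position \<open>t\<close>, where \<open>p\<close> passes above and \<open>q\<close> passes below the commutator.\<close>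

definition contact :: "'n commutator list \<Rightarrow> 'n list \<Rightarrow> 'n list \<Rightarrow> nat \<Rightarrow> bool" where
  "contact N p q t \<longleftrightarrow> t < length N \<and>
     p ! t = snd (N ! t) \<and> p ! Suc t = snd (N ! t) \<and>
     q ! t = fst (N ! t) \<and> q ! Suc t = fst (N ! t)"

text \<open>
  An arrangement is given as the family of its pseudolines, indexed by their starting levels.  Two
  pseudolines meet outside their common crossings exactly if they follow the same level on some
  interval: this includes the case of a commutator traversed by only one of them and having
  an endpoint on the other.
\<close>

definition arr :: "('n::{finite,linorder}) commutator list \<Rightarrow> ('n \<Rightarrow> 'n list) set" where
  "arr N = {\<Lambda>. (\<forall>i. pseudoline N (\<Lambda> i) \<and> \<Lambda> i ! 0 = i) \<and>
     (\<forall>i j. i \<noteq> j \<longrightarrow>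
        (\<exists>!t. crossing N (\<Lambda> i) (\<Lambda> j) t) \<and>
        (\<forall>t \<le> length N. \<Lambda> i ! t \<noteq> \<Lambda> j ! t))}"

definition sorting :: "('n::{finite,linorder}) commutator list \<Rightarrow> bool" where
  "sorting N \<longleftrightarrow> arr N \<noteq> {}"

text \<open>The brick \<open>(s, t)\<close> spans the intervals \<open>s + 1, \<dots>, t\<close>; its upper side is on level \<open>snd (N ! s)\<close>.\<close>

definition brick_below :: "('n::{finite,linorder}) commutator list \<Rightarrow> nat \<times> nat \<Rightarrow> 'n list \<Rightarrow> bool" where
  "brick_below N B p \<longleftrightarrow> (\<forall>u. fst B < u \<and> u \<le> snd B \<longrightarrow> snd (N ! fst B) \<le> p ! u)"

definition brick_vector ::
  "'n commutator list \<Rightarrow> ('n \<Rightarrow> 'n list) \<Rightarrow> real ^ ('n::{finite,linorder})" where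
  "brick_vector N \<Lambda> = (\<chi> i. real (card {B \<in> bricks N. brick_below N B (\<Lambda> i)}))"

definition brick_polytope :: "'n commutator list \<Rightarrow> (real ^ ('n::{finite,linorder})) set" where
  "brick_polytope N = convex hull (brick_vector N ` arr N)"

text \<open>
  The arc \<open>(i, t, j)\<close> is the contact at position \<open>t\<close> between the pseudolines \<open>i\<close> (above) and
  \<open>j\<close> (below); keeping \<open>t\<close> makes parallel arcs distinct.
\<close>

definition contact_graph ::
  "'n commutator list \<Rightarrow> ('n \<Rightarrow> 'n list) \<Rightarrow> ('n, 'n \<times> nat \<times> 'n) pre_digraph" where
  "contact_graph N \<Lambda> =
     \<lparr> verts = UNIV,
       arcs = {(i, t, j). contact N (\<Lambda> i) (\<Lambda> j) t},
       tail = (\<lambda>(i, t, j). i),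
       head = (\<lambda>(i, t, j). j) \<rparr>"

text \<open>\<^const>\<open>Digraph_Component.connected\<close> is connectedness of the underlying undirected graph.\<close>

definition irreducible_network :: "('n::{finite,linorder}) commutator list \<Rightarrow> bool" where
  "irreducible_network N \<longleftrightarrow> (\<forall>\<Lambda> \<in> arr N. Digraph_Component.connected (contact_graph N \<Lambda>))"

definition incidence_cone :: "('n::finite, 'e) pre_digraph \<Rightarrow> (real ^ 'n) set" where
  "incidence_cone G = convex_cone hull {axis (head G e) 1 - axis (tail G e) 1 | e. e \<in> arcs G}"

definition cone_at :: "(real ^ 'n) set \<Rightarrow> real ^ 'n \<Rightarrow> (real ^ 'n) set" where
  "cone_at P v = convex_cone hull {x - v | x. x \<in> P}"

end

theory Submission
  imports Defs
begin

text \<open>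
  Flipping a contact of \<open>\<Lambda>\<close> with \<open>i\<close> above \<open>j\<close>, that is exchanging it with the crossing of \<open>i\<close>
  and \<open>j\<close>, changes the brick vector by a positive multiple of \<open>e\<^sub>j - e\<^sub>i\<close>, whence one inclusion.
  For the other one, by separation, a linear functional \<open>a\<close> with \<open>a\<^sub>i \<le> a\<^sub>j\<close> for every arc \<open>(i, j)\<close>
  of the contact graph must attain at \<open>\<Lambda>\<close> its minimum over all brick vectors.
  For a linear order on the labels, there is at most one arrangement all of whose arcs increase:
  for the natural order it is obtained greedily from left to right, and exchanging two consecutive
  labels of the order amounts to a flip. Breaking the ties of \<open>a\<close> by flips, both \<open>\<Lambda>\<close> and a minimiser
  lead, without changing the value of \<open>a\<close>, to this unique arrangement.
\<close>

section \<open>Crossings as changes of the vertical order\<close>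

lemma network_nth:
  assumes "network N" "t < length N"
  obtains a b where "N ! t = (a, b)" "a < b" "\<And>x. x \<le> a \<or> b \<le> x"
proof -
  obtain a b where ab: "N ! t = (a, b)" by force
  have "(a, b) \<in> set N" using assms(2) ab by (metis nth_mem)
  then have "a < b" "{a<..<b} = {}" using assms(1) unfolding network_def by auto
  moreover have "x \<le> a \<or> b \<le> x" for x using \<open>{a<..<b} = {}\<close> by (metis empty_iff greaterThanLessThan_iff not_le)
  ultimately show thesis using that[OF ab] by blast
qed

lemma pseudoline_step:
  assumes "pseudoline N p" "t < length N" "N ! t = (a, b)"
  shows "p ! Suc t = p ! t \<or> p ! t = a \<and> p ! Suc t = b \<or> p ! t = b \<and> p ! Suc t = a"
proof -
  have "p ! Suc t = p ! t \<or> {p ! t, p ! Suc t} = {a, b}"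
    using assms unfolding pseudoline_def traverses_def by (metis fst_conv snd_conv)
  then show ?thesis unfolding doubleton_eq_iff by blast
qed

text \<open>No level lies strictly between the ends \<open>a < b\<close> of a commutator. So a path
  stepping from one end to the other can pass another path only if that one sits at the end being
  entered, and distinctness after the step then forces it to make the reverse move.\<close>

lemma crossing_iff_order_change:
  assumes "network N" "pseudoline N p" "pseudoline N q" "t < length N"
    and "p ! t \<noteq> q ! t" "p ! Suc t \<noteq> q ! Suc t"
  shows "crossing N p q t \<longleftrightarrow> (p ! t < q ! t) \<noteq> (p ! Suc t < q ! Suc t)"
proof -
  obtain a b where ab: "N ! t = (a, b)" "a < b" "\<And>x. x \<le> a \<or> b \<le> x"
    using network_nth[OF assms(1,4)] by blast
  have cr: "crossing N p q t \<longleftrightarrow> {p ! t, p ! Suc t} = {a, b} \<and> {q ! t, q ! Suc t} = {a, b}"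
    using ab assms(4) by (auto simp: crossing_def traverses_def)
  have x: "x < b \<longleftrightarrow> x \<le> a" "b < x \<longleftrightarrow> x \<noteq> b \<and> \<not> x \<le> a" for x
    using ab(2,3) by (meson leD le_less_trans less_le_not_le order.strict_iff_order not_le)+
  have "p ! t \<le> a \<or> b \<le> p ! t" "q ! t \<le> a \<or> b \<le> q ! t" using ab(3) by auto
  then show ?thesis
    using pseudoline_step[OF assms(2,4) ab(1)] pseudoline_step[OF assms(3,4) ab(1)] assms(5,6) ab(2)
    unfolding cr by (elim disjE conjE) (auto simp: doubleton_eq_iff)
qed

text \<open>Once \<open>j < i\<close> is rewritten as the negation of \<open>i < j\<close>, this
  turns the conditional of \<open>ordered_until\<close> into an equivalence, which treats both
  orders of the labels at once.\<close>

lemma if_bool_eq: "(if P then Q else \<not> Q) \<longleftrightarrow> P = Q"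
  by simp

text \<open>For distinct labels of a pseudoline family this expresses that \<open>c\<close> is their
  only crossing, in a form whose behaviour under flips can be read interval by interval. Interval
  \<open>c\<close> ends at the commutator at position \<open>c\<close>, so the initial order still
  holds there.\<close>

definition ordered_until :: "'n commutator list \<Rightarrow> ('n::{finite,linorder} \<Rightarrow> 'n list) \<Rightarrow> 'n \<Rightarrow> 'n \<Rightarrow> nat \<Rightarrow> bool" where
  "ordered_until N \<Lambda> i j c \<longleftrightarrow> c < length N \<and>
     (\<forall>u \<le> length N. \<Lambda> i ! u < \<Lambda> j ! u \<longleftrightarrow> (if u \<le> c then i < j else j < i))"

definition pseudoline_family :: "'n commutator list \<Rightarrow> ('n::{finite,linorder} \<Rightarrow> 'n list) \<Rightarrow> bool" where
  "pseudoline_family N \<Lambda> \<longleftrightarrow> (\<forall>i. pseudoline N (\<Lambda> i) \<and> \<Lambda> i ! 0 = i) \<and>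
     (\<forall>i j. i \<noteq> j \<longrightarrow> (\<forall>t \<le> length N. \<Lambda> i ! t \<noteq> \<Lambda> j ! t))"

text \<open>The order of the two paths starts as the order of their labels and toggles exactly at
  the crossings; a single crossing at \<open>c\<close> thus means a single toggle, between the
  intervals \<open>c\<close> and \<open>Suc c\<close>.\<close>

lemma crossing_iff_ordered_until:
  assumes "network N" "pseudoline_family N \<Lambda>" "i \<noteq> j"
  shows "(\<exists>!t. crossing N (\<Lambda> i) (\<Lambda> j) t) \<and> crossing N (\<Lambda> i) (\<Lambda> j) c \<longleftrightarrow> ordered_until N \<Lambda> i j c"
proof -
  let ?p = "\<Lambda> i" and ?q = "\<Lambda> j"
  have start: "?p ! 0 = i" "?q ! 0 = j" using assms(2) by (auto simp: pseudoline_family_def)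
  have ch: "crossing N ?p ?q u \<longleftrightarrow> (?p ! u < ?q ! u) \<noteq> (?p ! Suc u < ?q ! Suc u)"
    if "u < length N" for u
    using crossing_iff_order_change[of N ?p ?q u] assms that by (auto simp: pseudoline_family_def)
  have lt: "crossing N ?p ?q u \<Longrightarrow> u < length N" for u by (simp add: crossing_def)
  show ?thesis
  proof
    assume *: "(\<exists>!t. crossing N ?p ?q t) \<and> crossing N ?p ?q c"
    then have c: "c < length N" "\<And>u. crossing N ?p ?q u \<longleftrightarrow> u = c" using lt by auto
    have "u \<le> length N \<longrightarrow> (?p ! u < ?q ! u \<longleftrightarrow> (if u \<le> c then i < j else j < i))" for u
    proof (induction u)
      case 0 then show ?case using start by simp
    next
      case (Suc u)
      show ?case
      proof
        assume "Suc u \<le> length N"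
        then have "(?p ! u < ?q ! u \<longleftrightarrow> (if u \<le> c then i < j else j < i))"
          "(u = c) = ((?p ! u < ?q ! u) \<noteq> (?p ! Suc u < ?q ! Suc u))"
          using Suc ch[of u] c(2)[of u] by auto
        then show "?p ! Suc u < ?q ! Suc u \<longleftrightarrow> (if Suc u \<le> c then i < j else j < i)"
          using assms(3) by (cases "u = c"; cases "Suc u \<le> c") (auto split: if_splits)
      qed
    qed
    then show "ordered_until N \<Lambda> i j c" using c(1) by (simp add: ordered_until_def)
  next
    assume *: "ordered_until N \<Lambda> i j c"
    have "crossing N ?p ?q u \<longleftrightarrow> u = c" for u
    proof (cases "u < length N")
      case True
      then have "(?p ! u < ?q ! u) = (if u \<le> c then i < j else j < i)"
        "(?p ! Suc u < ?q ! Suc u) = (if Suc u \<le> c then i < j else j < i)"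
        using * by (auto simp: ordered_until_def)
      then show ?thesis unfolding ch[OF True] using assms(3) by (auto split: if_splits)
    next
      case False
      then show ?thesis using lt[of u] * by (auto simp: ordered_until_def)
    qed
    then show "(\<exists>!t. crossing N ?p ?q t) \<and> crossing N ?p ?q c" by auto
  qed
qed

lemma arr_iff:
  assumes "network N"
  shows "\<Lambda> \<in> arr N \<longleftrightarrow> pseudoline_family N \<Lambda> \<and> (\<forall>i j. i \<noteq> j \<longrightarrow> (\<exists>c. ordered_until N \<Lambda> i j c))"
proof -
  have "\<Lambda> \<in> arr N \<longleftrightarrow> pseudoline_family N \<Lambda> \<and> (\<forall>i j. i \<noteq> j \<longrightarrow> (\<exists>!t. crossing N (\<Lambda> i) (\<Lambda> j) t))"
    by (simp only: arr_def pseudoline_family_def mem_Collect_eq imp_conjR all_conj_distrib conj_ac)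
  then show ?thesis using crossing_iff_ordered_until[OF assms, of \<Lambda>] by blast
qed

lemma ordered_until_sym:
  assumes "pseudoline_family N \<Lambda>" "i \<noteq> j" "ordered_until N \<Lambda> i j c"
  shows "ordered_until N \<Lambda> j i c"
proof -
  have "\<Lambda> j ! u < \<Lambda> i ! u \<longleftrightarrow> \<not> \<Lambda> i ! u < \<Lambda> j ! u" if "u \<le> length N" for u
    using assms(1,2) that unfolding pseudoline_family_def by (metis not_less_iff_gr_or_eq)
  then show ?thesis using assms(2,3) unfolding ordered_until_def by auto
qed

section \<open>Meetings of two pseudolines, and flips\<close>

text \<open>The unordered pair covers crossings and contacts in both directions, and is insensitive
  to an exchange of the two labels.\<close>

definition meets :: "'n commutator list \<Rightarrow> 'n list \<Rightarrow> 'n list \<Rightarrow> nat \<Rightarrow> bool" where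
  "meets N p q t \<longleftrightarrow> t < length N \<and> {p ! t, q ! t} = {fst (N ! t), snd (N ! t)}"

lemma meets_Suc:
  assumes "pseudoline N p" "pseudoline N q" "meets N p q t" "p ! Suc t \<noteq> q ! Suc t"
  shows "{p ! Suc t, q ! Suc t} = {fst (N ! t), snd (N ! t)}"
proof -
  obtain a b where ab: "N ! t = (a, b)" by force
  have t: "t < length N" using assms(3) by (simp add: meets_def)
  show ?thesis
    using pseudoline_step[OF assms(1) t ab] pseudoline_step[OF assms(2) t ab] assms(3,4) ab
    by (auto simp: meets_def doubleton_eq_iff)
qed

lemma meets_cases:
  assumes "pseudoline N p" "pseudoline N q" "p ! t \<noteq> q ! t" "p ! Suc t \<noteq> q ! Suc t"
  shows "meets N p q t \<longleftrightarrow> crossing N p q t \<or> contact N p q t \<or> contact N q p t"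
proof (cases "t < length N")
  case True
  obtain a b where ab: "N ! t = (a, b)" by force
  show ?thesis
    using pseudoline_step[OF assms(1) True ab] pseudoline_step[OF assms(2) True ab] assms(3,4) ab True
    by (auto simp: meets_def crossing_def contact_def traverses_def doubleton_eq_iff)
qed (auto simp: meets_def crossing_def contact_def)

text \<open>The labels \<open>i\<close> and \<open>j\<close> are exchanged on the intervals strictly between the commutators
  \<open>s < t\<close>; this is a flip when one of the two is the crossing and the other one a contact.\<close>

definition flip ::
  "'n commutator list \<Rightarrow> 'n \<Rightarrow> 'n \<Rightarrow> nat \<Rightarrow> nat \<Rightarrow> ('n \<Rightarrow> 'n list) \<Rightarrow> 'n \<Rightarrow> 'n list" where
  "flip N i j s t \<Lambda> k = map (\<lambda>u. \<Lambda> (if s < u \<and> u \<le> t then Transposition.transpose i j k else k) ! u) [0..<Suc (length N)]"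

lemma flip_nth:
  "u \<le> length N \<Longrightarrow>
    flip N i j s t \<Lambda> k ! u = \<Lambda> (if s < u \<and> u \<le> t then Transposition.transpose i j k else k) ! u"
  unfolding flip_def by (subst nth_map) (auto simp del: upt_Suc)

lemma length_flip [simp]: "length (flip N i j s t \<Lambda> k) = Suc (length N)"
  by (simp add: flip_def)

text \<open>At a meeting, both paths occupy the two ends of the commutator before and after it. So a
  path that arrives along one of them and leaves along the other still either stays on its level or
  traverses the commutator.\<close>

lemma pseudoline_family_flip:
  assumes "network N" "pseudoline_family N \<Lambda>" "i \<noteq> j" "s < t"
    and s: "meets N (\<Lambda> i) (\<Lambda> j) s" and t: "meets N (\<Lambda> i) (\<Lambda> j) t"
  shows "pseudoline_family N (flip N i j s t \<Lambda>)"
proof -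
  have pl: "pseudoline N (\<Lambda> k)" and z: "\<Lambda> k ! 0 = k" for k
    using assms(2) by (auto simp: pseudoline_family_def)
  have dist: "\<Lambda> k ! u \<noteq> \<Lambda> l ! u" if "k \<noteq> l" "u \<le> length N" for k l u
    using assms(2) that by (auto simp: pseudoline_family_def)
  \<comment> \<open>\<open>*\<close> is for the entry into the exchanged zone at \<open>s\<close>,
    where the label changes after the commutator, and \<open>**\<close> for the exit at
    \<open>t\<close>.\<close>
  have *: "\<Lambda> (Transposition.transpose i j k) ! Suc u = \<Lambda> k ! u \<or>
      {\<Lambda> k ! u, \<Lambda> (Transposition.transpose i j k) ! Suc u} = {fst (N ! u), snd (N ! u)}"
    and **: "\<Lambda> k ! Suc u = \<Lambda> (Transposition.transpose i j k) ! u \<or>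
      {\<Lambda> (Transposition.transpose i j k) ! u, \<Lambda> k ! Suc u} = {fst (N ! u), snd (N ! u)}"
    if m: "meets N (\<Lambda> i) (\<Lambda> j) u" for u k
  proof -
    have u: "u < length N" using m by (simp add: meets_def)
    obtain a b where ab: "N ! u = (a, b)" by force
    have "{\<Lambda> i ! Suc u, \<Lambda> j ! Suc u} = {a, b}" "{\<Lambda> i ! u, \<Lambda> j ! u} = {a, b}"
      using meets_Suc[OF pl pl m] dist[OF assms(3), of "Suc u"] u m ab by (auto simp: meets_def)
    then have in_ab: "{\<Lambda> i ! u, \<Lambda> i ! Suc u, \<Lambda> j ! u, \<Lambda> j ! Suc u} \<subseteq> {a, b}" by blast
    have two: "y = x \<or> {x, y} = {a, b}" if "x \<in> {a, b}" "y \<in> {a, b}" for x y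
      using that by blast
    have ab': "{fst (N ! u), snd (N ! u)} = {a, b}" by (simp add: ab)
    have step: "\<Lambda> k ! Suc u = \<Lambda> k ! u \<or> {\<Lambda> k ! u, \<Lambda> k ! Suc u} = {a, b}"
      using pseudoline_step[OF pl u ab, of k] by blast
    consider "k = i" | "k = j" | "Transposition.transpose i j k = k"
      by (metis transpose_apply_other)
    then show "\<Lambda> (Transposition.transpose i j k) ! Suc u = \<Lambda> k ! u \<or>
      {\<Lambda> k ! u, \<Lambda> (Transposition.transpose i j k) ! Suc u} = {fst (N ! u), snd (N ! u)}"
      using two in_ab step unfolding ab' by cases (simp_all)
    consider "k = i" | "k = j" | "Transposition.transpose i j k = k"
      by (metis transpose_apply_other)
    then show "\<Lambda> k ! Suc u = \<Lambda> (Transposition.transpose i j k) ! u \<or>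
      {\<Lambda> (Transposition.transpose i j k) ! u, \<Lambda> k ! Suc u} = {fst (N ! u), snd (N ! u)}"
      using two in_ab step unfolding ab' by cases (simp_all)
  qed
  have "pseudoline N (flip N i j s t \<Lambda> k)" for k
  proof -
    have "flip N i j s t \<Lambda> k ! Suc u = flip N i j s t \<Lambda> k ! u \<or> traverses N (flip N i j s t \<Lambda> k) u"
      if u: "u < length N" for u
    proof -
      have st: "\<Lambda> l ! Suc u = \<Lambda> l ! u \<or> {\<Lambda> l ! u, \<Lambda> l ! Suc u} = {fst (N ! u), snd (N ! u)}" for l
        using pl[of l] u by (auto simp: pseudoline_def traverses_def)
      consider "u = s" | "u = t" | "s < u \<and> u \<le> t \<longleftrightarrow> s < Suc u \<and> Suc u \<le> t" by linarith
      then show ?thesis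
      proof cases
        case 1 then show ?thesis using u *[OF s, of k] assms(4) by (simp add: traverses_def flip_nth)
      next
        case 2 then show ?thesis using u **[OF t, of k] assms(4) by (simp add: traverses_def flip_nth)
      next
        case 3 then show ?thesis using u st by (simp add: traverses_def flip_nth)
      qed
    qed
    then show ?thesis by (simp add: pseudoline_def)
  qed
  moreover have "flip N i j s t \<Lambda> k ! 0 = k" for k by (simp add: flip_nth z)
  moreover have "flip N i j s t \<Lambda> k ! u \<noteq> flip N i j s t \<Lambda> l ! u" if "k \<noteq> l" "u \<le> length N" for k l u
    using that dist[of k l u] dist[of "Transposition.transpose i j k" "Transposition.transpose i j l" u]
      transpose_eq_imp_eq[of i j k l]
    by (auto simp: flip_nth)
  ultimately show ?thesis by (simp add: pseudoline_family_def)
qed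

lemma arr_pseudoline:
  assumes "\<Lambda> \<in> arr N"
  shows "pseudoline N (\<Lambda> i)" "\<Lambda> i ! 0 = i"
  using assms by (simp_all add: arr_def)

lemma arr_distinct:
  assumes "\<Lambda> \<in> arr N" "t \<le> length N"
  shows "\<Lambda> i ! t = \<Lambda> j ! t \<longleftrightarrow> i = j"
proof -
  have "i \<noteq> j \<Longrightarrow> \<forall>t \<le> length N. \<Lambda> i ! t \<noteq> \<Lambda> j ! t" using assms(1) by (simp add: arr_def)
  then show ?thesis using assms(2) by auto
qed

lemma arr_ordered_until:
  assumes "network N" "\<Lambda> \<in> arr N" "i \<noteq> j"
  obtains c where "ordered_until N \<Lambda> i j c"
proof -
  have "\<exists>c. ordered_until N \<Lambda> i j c" using iffD1[OF arr_iff[OF assms(1)] assms(2)] assms(3) by simp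
  then show thesis using that by blast
qed

lemma arr_crossing:
  assumes "network N" "\<Lambda> \<in> arr N" "i \<noteq> j"
  shows "crossing N (\<Lambda> i) (\<Lambda> j) c \<longleftrightarrow> ordered_until N \<Lambda> i j c"
proof -
  have fam: "pseudoline_family N \<Lambda>" using assms(2) arr_iff[OF assms(1), of \<Lambda>] by metis
  have ex: "\<exists>!t. crossing N (\<Lambda> i) (\<Lambda> j) t" using assms(2,3) unfolding arr_def by blast
  show ?thesis
    unfolding crossing_iff_ordered_until[OF assms(1) fam assms(3), symmetric] by (simp only: ex simp_thms)
qed

lemma arr_meets_Suc:
  assumes "\<Lambda> \<in> arr N" "i \<noteq> j" "meets N (\<Lambda> i) (\<Lambda> j) t"
  shows "{\<Lambda> i ! Suc t, \<Lambda> j ! Suc t} = {fst (N ! t), snd (N ! t)}"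
proof (rule meets_Suc[OF arr_pseudoline(1)[OF assms(1)] arr_pseudoline(1)[OF assms(1)] assms(3)])
  show "\<Lambda> i ! Suc t \<noteq> \<Lambda> j ! Suc t"
    using assms(2,3) by (simp add: arr_distinct[OF assms(1)] meets_def)
qed

lemma network_same_side:
  assumes "network N" "t < length N" "{x, y} = {fst (N ! t), snd (N ! t)}" "z \<noteq> x" "z \<noteq> y"
  shows "x < z \<longleftrightarrow> y < z"
proof -
  obtain a b where ab: "N ! t = (a, b)" "a < b" "\<And>x. x \<le> a \<or> b \<le> x"
    using network_nth[OF assms(1,2)] by blast
  have "a < z \<longleftrightarrow> b < z" if "z \<noteq> a" "z \<noteq> b"
    using ab(2) ab(3)[of z] that by auto
  then show ?thesis using assms(3-5) ab(1) by (auto simp: doubleton_eq_iff)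
qed

text \<open>Two pseudolines that meet at \<open>s\<close> and at \<open>t\<close> are on the same side of any third one both
  just after \<open>s\<close> and just before \<open>t\<close>; so they cross it both between \<open>s\<close> and \<open>t\<close>, or none of them does.\<close>

lemma ordered_until_flip_other:
  assumes "network N" "\<Lambda> \<in> arr N" "distinct [i, j, k]" "s < t"
    and s: "meets N (\<Lambda> i) (\<Lambda> j) s" and t: "meets N (\<Lambda> i) (\<Lambda> j) t"
  shows "\<exists>c. ordered_until N (flip N i j s t \<Lambda>) i k c"
proof -
  obtain c d where c: "ordered_until N \<Lambda> i k c" and d: "ordered_until N \<Lambda> j k d"
    using assms(3) arr_ordered_until[OF assms(1,2), of i k] arr_ordered_until[OF assms(1,2), of j k]
    by (metis distinct_length_2_or_more)
  have st: "s < length N" "t < length N" using s t by (auto simp: meets_def)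
  have ord: "k < i \<longleftrightarrow> \<not> i < k" "k < j \<longleftrightarrow> \<not> j < k" using assms(3) by auto
  have x: "(\<Lambda> i ! u < \<Lambda> k ! u) = ((u \<le> c) = (i < k))"
    and y: "(\<Lambda> j ! u < \<Lambda> k ! u) = ((u \<le> d) = (j < k))" if "u \<le> length N" for u
    using c d that by (simp_all add: ordered_until_def ord if_bool_eq)
  have ou: "ordered_until N \<Lambda>' i k e \<longleftrightarrow> e < length N \<and>
      (\<forall>u \<le> length N. \<Lambda>' i ! u < \<Lambda>' k ! u \<longleftrightarrow> ((u \<le> e) = (i < k)))" for \<Lambda>' e
    unfolding ordered_until_def ord if_bool_eq ..
  have s': "(\<Lambda> i ! Suc s < \<Lambda> k ! Suc s) = (\<Lambda> j ! Suc s < \<Lambda> k ! Suc s)"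
    using network_same_side[OF assms(1) st(1) arr_meets_Suc[OF assms(2) _ s]]
      assms(3) arr_distinct[OF assms(2), of "Suc s"] st by auto
  have t': "(\<Lambda> i ! t < \<Lambda> k ! t) = (\<Lambda> j ! t < \<Lambda> k ! t)"
    using network_same_side[OF assms(1) st(2)] t
      assms(3) arr_distinct[OF assms(2), of t] st by (auto simp: meets_def)
  have ends: "((Suc s \<le> c) = (i < k)) = ((Suc s \<le> d) = (j < k))" "((t \<le> c) = (i < k)) = ((t \<le> d) = (j < k))"
    using s' t' x[of "Suc s"] y[of "Suc s"] x[of t] y[of t] st by simp_all
  \<comment> \<open>The comparison with \<open>k\<close> differs between the two ends of the zone
    for \<open>i\<close> exactly when it does for \<open>j\<close>, so \<open>c\<close> lies
    strictly between \<open>s\<close> and \<open>t\<close> iff \<open>d\<close> does. If they do,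
    the new path of \<open>i\<close> crosses that of \<open>k\<close> at \<open>d\<close>. If not,
    both comparisons are constant on the zone and agree there, so the crossing remains at
    \<open>c\<close>.\<close>
  have inside: "s < d \<and> d < t \<and> A = B"
    if "s < c" "c < t" "((Suc s \<le> c) = A) = ((Suc s \<le> d) = B)" "((t \<le> c) = A) = ((t \<le> d) = B)" for A B
    using that by (cases A; cases B) auto
  have outside: "((u \<le> c) = A) = ((u \<le> d) = B)"
    if "\<not> (s < c \<and> c < t)" "((Suc s \<le> c) = A) = ((Suc s \<le> d) = B)" "((t \<le> c) = A) = ((t \<le> d) = B)"
      "s < u" "u \<le> t" for A B u
    using that by (cases A; cases B) auto
  have k: "Transposition.transpose i j k = k" using assms(3) by auto
  have z: "(flip N i j s t \<Lambda> i ! u < flip N i j s t \<Lambda> k ! u) =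
     (if s < u \<and> u \<le> t then (u \<le> d) = (j < k) else (u \<le> c) = (i < k))"
    if "u \<le> length N" for u
    using x[OF that] y[OF that] by (simp add: flip_nth[OF that] k)
  show ?thesis
  proof (cases "s < c \<and> c < t")
    case True
    then have "s < d" "d < t" "(i < k) = (j < k)" using inside[OF _ _ ends] by auto
    then have "ordered_until N (flip N i j s t \<Lambda>) i k d"
      using True z st unfolding ou by auto
    then show ?thesis by blast
  next
    case False
    have "ordered_until N (flip N i j s t \<Lambda>) i k c"
      using outside[OF False ends] z c unfolding ou by simp
    then show ?thesis by blast
  qed
qed

text \<open>On the zone the order of \<open>i\<close> and \<open>j\<close> is reversed. When their
  order changed at one end of the zone, the reversal removes this change and creates one at the
  other end.\<close>

lemma ordered_until_flip_pair:
  assumes "network N" "\<Lambda> \<in> arr N" "i \<noteq> j" "s < t" "t < length N"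
  shows "crossing N (\<Lambda> i) (\<Lambda> j) s \<Longrightarrow> ordered_until N (flip N i j s t \<Lambda>) i j t"
    and "crossing N (\<Lambda> i) (\<Lambda> j) t \<Longrightarrow> ordered_until N (flip N i j s t \<Lambda>) i j s"
proof -
  have ord: "j < i \<longleftrightarrow> \<not> i < j" using assms(3) by auto
  have ou: "ordered_until N \<Lambda>' i j e \<longleftrightarrow> e < length N \<and>
      (\<forall>u \<le> length N. \<Lambda>' i ! u < \<Lambda>' j ! u \<longleftrightarrow> ((u \<le> e) = (i < j)))" for \<Lambda>' e
    unfolding ordered_until_def ord if_bool_eq ..
  have z: "(flip N i j s t \<Lambda> i ! u < flip N i j s t \<Lambda> j ! u) =
     (if s < u \<and> u \<le> t then \<not> \<Lambda> i ! u < \<Lambda> j ! u else \<Lambda> i ! u < \<Lambda> j ! u)" if "u \<le> length N" for u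
    using arr_distinct[OF assms(2) that, of i j] assms(3) by (auto simp: flip_nth[OF that])
  show "ordered_until N (flip N i j s t \<Lambda>) i j t" if "crossing N (\<Lambda> i) (\<Lambda> j) s"
    using that assms(3-5) z unfolding arr_crossing[OF assms(1-3)] ou by auto
  show "ordered_until N (flip N i j s t \<Lambda>) i j s" if "crossing N (\<Lambda> i) (\<Lambda> j) t"
    using that assms(3-5) z unfolding arr_crossing[OF assms(1-3)] ou by auto
qed

lemma flip_commute: "flip N i j s t \<Lambda> = flip N j i s t \<Lambda>"
  unfolding flip_def transpose_commute[of i j] ..

lemma meets_commute: "meets N p q t = meets N q p t"
  unfolding meets_def insert_commute[of "q ! t"] ..

lemma crossing_commute: "crossing N p q t = crossing N q p t"
  unfolding crossing_def by blast

text \<open>Pairs of labels are sorted by how many of them are \<open>i\<close> or \<open>j\<close>: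
  the pair itself moves its crossing, a pair with one of them exchanges crossings inside the zone or
  keeps them, and the other pairs are not affected.\<close>

lemma flip_in_arr:
  assumes "network N" "\<Lambda> \<in> arr N" "i \<noteq> j" "s < t"
    and s: "meets N (\<Lambda> i) (\<Lambda> j) s" and t: "meets N (\<Lambda> i) (\<Lambda> j) t"
    and c: "crossing N (\<Lambda> i) (\<Lambda> j) s \<or> crossing N (\<Lambda> i) (\<Lambda> j) t"
  shows "flip N i j s t \<Lambda> \<in> arr N"
proof -
  let ?F = "flip N i j s t \<Lambda>"
  have fam: "pseudoline_family N ?F"
    using pseudoline_family_flip assms arr_iff by blast
  have ij: "\<exists>c. ordered_until N ?F i j c"
    using ordered_until_flip_pair[OF assms(1-4)] c t by (auto simp: meets_def)
  have ik: "\<exists>c. ordered_until N ?F i k c" if "k \<noteq> i" "k \<noteq> j" for k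
    using ordered_until_flip_other[OF assms(1,2) _ assms(4) s t, of k] that assms(3) by simp
  have jk: "\<exists>c. ordered_until N ?F j k c" if "k \<noteq> i" "k \<noteq> j" for k
    using ordered_until_flip_other[OF assms(1,2) _ assms(4), of j i k] s t that assms(3)
    by (simp add: meets_commute flip_commute[of N j i])
  have "\<exists>c. ordered_until N ?F k l c" if "k \<noteq> l" for k l
  proof (cases "k \<in> {i, j} \<or> l \<in> {i, j}")
    case True
    then show ?thesis
      using ij ik[of k] ik[of l] jk[of k] jk[of l] ordered_until_sym[OF fam] that
      by (metis empty_iff insert_iff)
  next
    case False
    obtain c where "ordered_until N \<Lambda> k l c" using arr_ordered_until[OF assms(1,2) \<open>k \<noteq> l\<close>] .
    then have "ordered_until N ?F k l c" using False by (simp add: ordered_until_def flip_nth)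
    then show ?thesis by blast
  qed
  then show ?thesis using fam arr_iff[OF assms(1)] by blast
qed

lemma contact_meets: "contact N p q u \<Longrightarrow> meets N p q u"
  by (auto simp: contact_def meets_def)

text \<open>This is what later allows a flip between the first and the last meeting to be undone by
  the same construction.\<close>

lemma meets_flip:
  assumes "i \<noteq> j"
  shows "meets N (flip N i j s t \<Lambda> i) (flip N i j s t \<Lambda> j) u = meets N (\<Lambda> i) (\<Lambda> j) u"
proof (cases "u < length N")
  case True
  then have "flip N i j s t \<Lambda> i ! u = (if s < u \<and> u \<le> t then \<Lambda> j ! u else \<Lambda> i ! u)"
    "flip N i j s t \<Lambda> j ! u = (if s < u \<and> u \<le> t then \<Lambda> i ! u else \<Lambda> j ! u)"
    by (auto simp: flip_nth)
  then show ?thesis unfolding meets_def by (auto split: if_splits)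
qed (simp add: meets_def)

text \<open>Strictly inside the zone an old contact reappears with exchanged labels, and outside it
  is kept. At \<open>s\<close> and \<open>t\<close> both ends of the commutator are taken by
  \<open>i\<close> and \<open>j\<close>, so no other label can be involved.\<close>

lemma contact_flip:
  assumes "\<Lambda> \<in> arr N" "i \<noteq> j" "s < t"
    and s: "meets N (\<Lambda> i) (\<Lambda> j) s" and t: "meets N (\<Lambda> i) (\<Lambda> j) t"
    and c: "contact N (flip N i j s t \<Lambda> k) (flip N i j s t \<Lambda> l) u"
  shows "{k, l} = {i, j} \<or> contact N (\<Lambda> k) (\<Lambda> l) u \<or>
    contact N (\<Lambda> (Transposition.transpose i j k)) (\<Lambda> (Transposition.transpose i j l)) u"
proof -
  have u: "u < length N" using c by (simp add: contact_def)
  have F: "flip N i j s t \<Lambda> k ! u = snd (N ! u)" "flip N i j s t \<Lambda> l ! u = fst (N ! u)"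
    "flip N i j s t \<Lambda> k ! Suc u = snd (N ! u)" "flip N i j s t \<Lambda> l ! Suc u = fst (N ! u)"
    using c by (simp_all add: contact_def)
  consider "u = s" | "u = t" | "s < u" "u < t" | "u < s \<or> t < u" by linarith
  then show ?thesis
  proof cases
    case 1
    then have "\<Lambda> k ! u = snd (N ! u)" "\<Lambda> l ! u = fst (N ! u)" using F u by (auto simp: flip_nth)
    moreover have "{\<Lambda> i ! u, \<Lambda> j ! u} = {fst (N ! u), snd (N ! u)}" using s 1 by (simp add: meets_def)
    ultimately have "{k, l} = {i, j}" using arr_distinct[OF assms(1), of u] u
      unfolding doubleton_eq_iff by (metis less_imp_le)
    then show ?thesis by blast
  next
    \<comment> \<open>Interval \<open>t\<close> still belongs to the zone, so the original labels
      are read off just after the commutator instead.\<close>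
    case 2
    then have "\<Lambda> k ! Suc u = snd (N ! u)" "\<Lambda> l ! Suc u = fst (N ! u)"
      using F u assms(3) by (auto simp: flip_nth)
    moreover have "{\<Lambda> i ! Suc u, \<Lambda> j ! Suc u} = {fst (N ! u), snd (N ! u)}"
      using arr_meets_Suc[OF assms(1,2) t] 2 by simp
    ultimately have "{k, l} = {i, j}" using arr_distinct[OF assms(1), of "Suc u"] u
      unfolding doubleton_eq_iff by (metis Suc_leI)
    then show ?thesis by blast
  next
    case 3 then show ?thesis using c u by (simp add: contact_def flip_nth)
  next
    case 4 then show ?thesis using c u by (auto simp: contact_def flip_nth)
  qed
qed

section \<open>Bricks, and the change of the brick vector under a flip\<close>

lemma network_snd_inj:
  assumes "network N" "s < length N" "t < length N" "snd (N ! s) = snd (N ! t)"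
  shows "N ! s = N ! t"
proof -
  obtain a b where s: "N ! s = (a, b)" "a < b" "\<And>x. x \<le> a \<or> b \<le> x"
    using network_nth[OF assms(1,2)] by blast
  obtain a' b' where t: "N ! t = (a', b')" "a' < b'" "\<And>x. x \<le> a' \<or> b' \<le> x"
    using network_nth[OF assms(1,3)] by blast
  have "a = a'" using s(2) s(3)[of a'] t(2) t(3)[of a] assms(4) s(1) t(1) by auto
  then show ?thesis using s t assms(4) by simp
qed

text \<open>A path can pass between the levels below \<open>snd (N ! r)\<close> and the others only
  at a commutator with this upper end, which by \<open>network_snd_inj\<close> is a copy of
  \<open>N ! r\<close>.\<close>

lemma pseudoline_same_side:
  assumes "network N" "pseudoline N p" "r < length N" "v \<le> w" "w \<le> length N"
    and "\<And>u. v \<le> u \<Longrightarrow> u < w \<Longrightarrow> N ! u \<noteq> N ! r"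
  shows "snd (N ! r) \<le> p ! v \<longleftrightarrow> snd (N ! r) \<le> p ! w"
  using assms(4-6)
proof (induction w rule: dec_induct)
  case (step u)
  obtain a b where ab: "N ! u = (a, b)" "a < b" "\<And>x. x \<le> a \<or> b \<le> x"
    using network_nth[OF assms(1), of u] step by (metis Suc_le_lessD)
  have "snd (N ! r) \<noteq> b" using network_snd_inj[OF assms(1,3), of u] step ab by auto
  then have "snd (N ! r) \<le> a \<longleftrightarrow> snd (N ! r) \<le> b" using ab(2) ab(3)[of "snd (N ! r)"] by auto
  then have "snd (N ! r) \<le> p ! u \<longleftrightarrow> snd (N ! r) \<le> p ! Suc u"
    using pseudoline_step[OF assms(2) _ ab(1)] step by auto
  then show ?case using step by simp
qed simp

text \<open>Between the two ends of a brick no commutator joins its two levels, so a path does not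
  change sides and any one interval decides.\<close>

lemma brick_below_iff:
  assumes "network N" "pseudoline N p" "(s, t) \<in> bricks N" "s < v" "v \<le> t"
  shows "brick_below N (s, t) p \<longleftrightarrow> snd (N ! s) \<le> p ! v"
proof -
  have st: "t < length N" "\<And>u. s < u \<Longrightarrow> u < t \<Longrightarrow> N ! u \<noteq> N ! s"
    using assms(3) by (auto simp: bricks_def)
  have "snd (N ! s) \<le> p ! u \<longleftrightarrow> snd (N ! s) \<le> p ! t" if "s < u" "u \<le> t" for u
    using pseudoline_same_side[OF assms(1,2), of s u t] that st by auto
  then have "snd (N ! s) \<le> p ! u \<longleftrightarrow> snd (N ! s) \<le> p ! v" if "s < u" "u \<le> t" for u
    using that assms(4,5) by blast
  then show ?thesis unfolding brick_below_def fst_conv snd_conv using assms(4,5) by blast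
qed

lemma finite_bricks: "finite (bricks N)"
proof (rule finite_subset)
  show "bricks N \<subseteq> {..<length N} \<times> {..<length N}"
    unfolding bricks_def by clarify (intro conjI lessThan_iff[THEN iffD2]; linarith)
qed simp

text \<open>A brick may straddle an end of the zone; since one interval decides, it is tested on its
  last one, \<open>snd B\<close>, only.\<close>

lemma brick_below_flip:
  assumes "network N" "\<Lambda> \<in> arr N" "flip N i j s t \<Lambda> \<in> arr N" "B \<in> bricks N"
  shows "brick_below N B (flip N i j s t \<Lambda> k) \<longleftrightarrow>
    brick_below N B (\<Lambda> (if s < snd B \<and> snd B \<le> t then Transposition.transpose i j k else k))"
proof -
  obtain v w where B: "B = (v, w)" by force
  have vw: "(v, w) \<in> bricks N" "v < w" "w \<le> length N" using assms(4) B by (auto simp: bricks_def)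
  have "brick_below N (v, w) p \<longleftrightarrow> snd (N ! v) \<le> p ! w" if "pseudoline N p" for p
    using brick_below_iff[OF assms(1) that vw(1) vw(2)] by simp
  then show ?thesis
    using arr_pseudoline(1)[OF assms(2)] arr_pseudoline(1)[OF assms(3)] vw
    by (simp add: B flip_nth)
qed

lemma crossing_order:
  assumes "network N" "\<Lambda> \<in> arr N" "i \<noteq> j" "crossing N (\<Lambda> i) (\<Lambda> j) c" "u \<le> length N"
  shows "\<Lambda> i ! u < \<Lambda> j ! u \<longleftrightarrow> (u \<le> c \<longleftrightarrow> i < j)"
    and "\<Lambda> j ! u < \<Lambda> i ! u \<longleftrightarrow> (u \<le> c \<longleftrightarrow> j < i)"
proof -
  have ord: "j < i \<longleftrightarrow> \<not> i < j" "\<Lambda> j ! u < \<Lambda> i ! u \<longleftrightarrow> \<not> \<Lambda> i ! u < \<Lambda> j ! u"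
    using assms(3) arr_distinct[OF assms(2,5), of i j] by auto
  show "\<Lambda> i ! u < \<Lambda> j ! u \<longleftrightarrow> (u \<le> c \<longleftrightarrow> i < j)"
    using assms(4,5) unfolding arr_crossing[OF assms(1-3)] ordered_until_def ord if_bool_eq by blast
  then show "\<Lambda> j ! u < \<Lambda> i ! u \<longleftrightarrow> (u \<le> c \<longleftrightarrow> j < i)" unfolding ord by blast
qed

lemma contact_less:
  assumes "network N" "contact N p q t"
  shows "q ! t < p ! t" "q ! Suc t < p ! Suc t" "t < length N"
proof -
  show t: "t < length N" using assms(2) by (simp add: contact_def)
  obtain a b where "N ! t = (a, b)" "a < b" using network_nth[OF assms(1) t] by blast
  then show "q ! t < p ! t" "q ! Suc t < p ! Suc t" using assms(2) by (simp_all add: contact_def)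
qed

text \<open>The order of \<open>i\<close> and \<open>j\<close> changes only at their crossing, which
  is one end of the zone; so throughout the zone it is the order seen at the contact, the other
  end.\<close>

lemma contact_above:
  assumes "network N" "\<Lambda> \<in> arr N" "s < t" "s < u" "u \<le> t"
    and "contact N (\<Lambda> i) (\<Lambda> j) s \<and> crossing N (\<Lambda> i) (\<Lambda> j) t \<or>
      crossing N (\<Lambda> i) (\<Lambda> j) s \<and> contact N (\<Lambda> i) (\<Lambda> j) t"
  shows "\<Lambda> j ! u < \<Lambda> i ! u"
proof -
  have ij: "i \<noteq> j" using assms(6) contact_less[OF assms(1)] by blast
  have t: "t < length N" using assms(6) by (auto simp: contact_def crossing_def)
  note order = crossing_order(2)[OF assms(1,2) ij]
  show ?thesis
    using assms(6)
  proof
    assume *: "contact N (\<Lambda> i) (\<Lambda> j) s \<and> crossing N (\<Lambda> i) (\<Lambda> j) t"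
    then have "\<Lambda> j ! s < \<Lambda> i ! s" using contact_less[OF assms(1)] by blast
    then show ?thesis using order[of t s] order[of t u] * assms(3-5) t by simp
  next
    assume *: "crossing N (\<Lambda> i) (\<Lambda> j) s \<and> contact N (\<Lambda> i) (\<Lambda> j) t"
    then have "\<Lambda> j ! t < \<Lambda> i ! t" using contact_less[OF assms(1)] by blast
    then show ?thesis using order[of s t] order[of s u] * assms(3-5) t by simp
  qed
qed

text \<open>The brick next to the contact, on the side of the crossing, is bounded: otherwise the two
  pseudolines would stay on either side of the levels of the contact and could not cross.\<close>

lemma brick_between:
  assumes "network N" "\<Lambda> \<in> arr N" "s < t"
    and "contact N (\<Lambda> i) (\<Lambda> j) s \<and> crossing N (\<Lambda> i) (\<Lambda> j) t \<or>
      crossing N (\<Lambda> i) (\<Lambda> j) s \<and> contact N (\<Lambda> i) (\<Lambda> j) t"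
  shows "\<exists>B \<in> bricks N. s < snd B \<and> snd B \<le> t \<and> brick_below N B (\<Lambda> i) \<and> \<not> brick_below N B (\<Lambda> j)"
proof -
  note pl = arr_pseudoline(1)[OF assms(2)]
  have ij: "i \<noteq> j" using assms(4) contact_less[OF assms(1)] by blast
  note order = crossing_order(2)[OF assms(1,2) ij]
  have st: "s < length N" "t < length N" using assms(4) by (auto simp: contact_def crossing_def)
  have sides: "snd (N ! r) \<le> \<Lambda> i ! r" "\<not> snd (N ! r) \<le> \<Lambda> j ! r"
    "snd (N ! r) \<le> \<Lambda> i ! Suc r" "\<not> snd (N ! r) \<le> \<Lambda> j ! Suc r"
    if "contact N (\<Lambda> i) (\<Lambda> j) r" for r
    using contact_less[OF assms(1) that] that by (simp_all add: contact_def)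
  show ?thesis
    using assms(4)
  proof
    assume *: "contact N (\<Lambda> i) (\<Lambda> j) s \<and> crossing N (\<Lambda> i) (\<Lambda> j) t"
    note start = sides(3,4)[OF conjunct1[OF *]]
    have "\<Lambda> j ! t < \<Lambda> i ! t" using contact_above[OF assms(1-3) _ _ assms(4)] assms(3) by simp
    then have after: "\<not> \<Lambda> j ! Suc t < \<Lambda> i ! Suc t"
      using order[of t t] order[of t "Suc t"] * st by simp
    have "\<exists>u. s < u \<and> u \<le> t \<and> N ! u = N ! s"
    proof (rule ccontr)
      assume no: "\<nexists>u. s < u \<and> u \<le> t \<and> N ! u = N ! s"
      have "snd (N ! s) \<le> \<Lambda> k ! Suc s \<longleftrightarrow> snd (N ! s) \<le> \<Lambda> k ! Suc t" for k
        by (rule pseudoline_same_side[OF assms(1) pl st(1)]) (use no assms(3) st in auto)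
      then have "snd (N ! s) \<le> \<Lambda> i ! Suc t" "\<not> snd (N ! s) \<le> \<Lambda> j ! Suc t" using start by blast+
      then show False using after by simp
    qed
    \<comment> \<open>The first later commutator on the levels of the contact closes the brick that
      the contact opens; it may be at \<open>t\<close> itself.\<close>
    then obtain u where u: "s < u" "u \<le> t" "N ! u = N ! s"
      "\<And>v. v < u \<Longrightarrow> \<not> (s < v \<and> v \<le> t \<and> N ! v = N ! s)"
      using exists_least_iff[of "\<lambda>u. s < u \<and> u \<le> t \<and> N ! u = N ! s"] by blast
    then have B: "(s, u) \<in> bricks N" using st by (auto simp: bricks_def)
    show ?thesis
      using u(1,2) start brick_below_iff[OF assms(1) pl B, of "Suc s"] by (intro bexI[OF _ B]) simp
  next
    assume *: "crossing N (\<Lambda> i) (\<Lambda> j) s \<and> contact N (\<Lambda> i) (\<Lambda> j) t"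
    note start = sides(1,2)[OF conjunct2[OF *]]
    have "\<Lambda> j ! Suc s < \<Lambda> i ! Suc s" using contact_above[OF assms(1-3) _ _ assms(4)] assms(3) by simp
    then have after: "\<not> \<Lambda> j ! s < \<Lambda> i ! s"
      using order[of s s] order[of s "Suc s"] * st by simp
    have "\<exists>u. u < t \<and> s \<le> u \<and> N ! u = N ! t"
    proof (rule ccontr)
      assume no: "\<nexists>u. u < t \<and> s \<le> u \<and> N ! u = N ! t"
      have "snd (N ! t) \<le> \<Lambda> k ! s \<longleftrightarrow> snd (N ! t) \<le> \<Lambda> k ! t" for k
        by (rule pseudoline_same_side[OF assms(1) pl st(2)]) (use no assms(3) st in auto)
      then have "snd (N ! t) \<le> \<Lambda> i ! s" "\<not> snd (N ! t) \<le> \<Lambda> j ! s" using start by blast+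
      then show False using after by simp
    qed
    then obtain w where w: "w < t \<and> s \<le> w \<and> N ! w = N ! t" by blast
    \<comment> \<open>In the mirror case the last earlier commutator on these levels opens the brick
      that the contact closes; it may be at \<open>s\<close> itself.\<close>
    define u where "u = (GREATEST u. u < t \<and> s \<le> u \<and> N ! u = N ! t)"
    have u: "u < t \<and> s \<le> u \<and> N ! u = N ! t"
      unfolding u_def using w by (rule GreatestI_nat[where b = t]) simp
    have u_max: "v \<le> u" if "v < t \<and> s \<le> v \<and> N ! v = N ! t" for v
      unfolding u_def using that by (rule Greatest_le_nat[where b = t]) simp
    have B: "(u, t) \<in> bricks N"
      using st u u_max by (auto simp: bricks_def) (meson less_imp_le not_le order_trans)
    show ?thesis
      using u start assms(3) brick_below_iff[OF assms(1) pl B, of t] by (intro bexI[OF _ B]) simp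
  qed
qed

text \<open>Only the bricks ending in the zone, the set \<open>D\<close>, are counted differently:
  there \<open>i\<close> and \<open>j\<close> exchange the bricks below them. As \<open>i\<close>
  runs above \<open>j\<close> on the zone, \<open>j\<close> gains what \<open>i\<close> loses,
  namely the bricks of \<open>D\<close> between the two, and \<open>brick_between\<close> provides
  at least one.\<close>

lemma brick_vector_flip:
  assumes "network N" "\<Lambda> \<in> arr N" "s < t" "flip N i j s t \<Lambda> \<in> arr N"
    and "contact N (\<Lambda> i) (\<Lambda> j) s \<and> crossing N (\<Lambda> i) (\<Lambda> j) t \<or>
      crossing N (\<Lambda> i) (\<Lambda> j) s \<and> contact N (\<Lambda> i) (\<Lambda> j) t"
  shows "\<exists>c > 0. brick_vector N (flip N i j s t \<Lambda>) - brick_vector N \<Lambda> = c *\<^sub>R (axis j 1 - axis i 1)"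
proof -
  let ?F = "flip N i j s t \<Lambda>"
  note pl = arr_pseudoline(1)[OF assms(2)]
  define D where "D = {B \<in> bricks N. s < snd B \<and> snd B \<le> t}"
  define A where "A = (\<lambda>k. {B \<in> bricks N. brick_below N B (\<Lambda> k)})"
  define A' where "A' = (\<lambda>k. {B \<in> bricks N. brick_below N B (?F k)})"
  have fin: "finite (A k)" for k using finite_bricks[of N] by (simp add: A_def)
  have A': "A' k = (A k - D) \<union> (A (Transposition.transpose i j k) \<inter> D)" for k
  proof (rule set_eqI)
    fix B
    show "B \<in> A' k \<longleftrightarrow> B \<in> (A k - D) \<union> (A (Transposition.transpose i j k) \<inter> D)"
    proof (cases "B \<in> bricks N")
      case True
      show ?thesis using brick_below_flip[OF assms(1,2,4) True, of k] True
        by (cases "s < snd B \<and> snd B \<le> t") (auto simp: A_def A'_def D_def)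
    qed (simp add: A_def A'_def D_def)
  qed
  have card: "card (A' k) + card (A k \<inter> D) = card (A k) + card (A (Transposition.transpose i j k) \<inter> D)" for k
  proof -
    have "card (A k) = card (A k - D) + card (A k \<inter> D)"
      using card_Diff_subset_Int[of "A k" D] fin[of k] card_mono[of "A k" "A k \<inter> D"] by auto
    moreover have "card (A' k) = card (A k - D) + card (A (Transposition.transpose i j k) \<inter> D)"
      unfolding A' using fin by (intro card_Un_disjoint) auto
    ultimately show ?thesis by simp
  qed
  have sub: "A j \<inter> D \<subseteq> A i \<inter> D"
  proof
    fix B assume B: "B \<in> A j \<inter> D"
    obtain v w where vw: "B = (v, w)" by force
    have b: "(v, w) \<in> bricks N" "v < w" "s < w" "w \<le> t" using B vw by (auto simp: A_def D_def bricks_def)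
    have "snd (N ! v) \<le> \<Lambda> j ! w"
      using B vw brick_below_iff[OF assms(1) pl b(1,2)] by (auto simp: A_def)
    then have "snd (N ! v) \<le> \<Lambda> i ! w"
      using contact_above[OF assms(1-3) b(3,4) assms(5)] by auto
    then show "B \<in> A i \<inter> D"
      using B vw brick_below_iff[OF assms(1) pl b(1,2)] by (auto simp: A_def)
  qed
  moreover obtain B where "B \<in> A i \<inter> D" "B \<notin> A j"
    using brick_between[OF assms(1-3,5)] by (auto simp: A_def D_def)
  ultimately have lt: "card (A j \<inter> D) < card (A i \<inter> D)"
    using fin by (intro psubset_card_mono) auto
  define c where "c = real (card (A i \<inter> D)) - real (card (A j \<inter> D))"
  have ij: "i \<noteq> j" using lt by auto
  have "brick_vector N ?F - brick_vector N \<Lambda> = c *\<^sub>R (axis j 1 - axis i 1)"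
  proof (rule vec_eq_iff[THEN iffD2], rule allI)
    fix k
    have "real (card (A' k)) - real (card (A k)) =
      real (card (A (Transposition.transpose i j k) \<inter> D)) - real (card (A k \<inter> D))"
      using card[of k] by linarith
    moreover consider "k = i" | "k = j" | "k \<noteq> i" "k \<noteq> j" by blast
    ultimately show "(brick_vector N ?F - brick_vector N \<Lambda>) $ k = (c *\<^sub>R (axis j 1 - axis i 1)) $ k"
      unfolding brick_vector_def A_def[symmetric] A'_def[symmetric]
      using ij by cases (auto simp: c_def axis_def A_def A'_def)
  qed
  moreover have "c > 0" using lt by (simp add: c_def)
  ultimately show ?thesis by blast
qed

section \<open>Every contact can be flipped\<close>

lemma arr_meets_iff:
  assumes "\<Lambda> \<in> arr N" "i \<noteq> j"
  shows "meets N (\<Lambda> i) (\<Lambda> j) t \<longleftrightarrow>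
    crossing N (\<Lambda> i) (\<Lambda> j) t \<or> contact N (\<Lambda> i) (\<Lambda> j) t \<or> contact N (\<Lambda> j) (\<Lambda> i) t"
proof (cases "t < length N")
  case True
  have "\<Lambda> i ! t \<noteq> \<Lambda> j ! t" "\<Lambda> i ! Suc t \<noteq> \<Lambda> j ! Suc t"
    using arr_distinct[OF assms(1)] assms(2) True by (simp_all add: Suc_leI)
  then show ?thesis by (rule meets_cases[OF arr_pseudoline(1)[OF assms(1)] arr_pseudoline(1)[OF assms(1)]])
qed (auto simp: meets_def crossing_def contact_def)

lemma contact_not_crossing:
  assumes "network N" "contact N p q t"
  shows "\<not> crossing N p q' t"
proof
  obtain a b where ab: "N ! t = (a, b)" "a < b"
    using network_nth[OF assms(1) contact_less(3)[OF assms]] by blast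
  assume "crossing N p q' t"
  then have "{p ! t, p ! Suc t} = {a, b}" using ab by (simp add: crossing_def traverses_def)
  moreover have "p ! t = b" "p ! Suc t = b" using assms(2) ab by (simp_all add: contact_def)
  ultimately show False using ab(2) by (metis insert_iff less_irrefl singletonD)
qed

text \<open>This forgets the positions of the flip. The last clause only bounds the new contacts,
  which suffices to carry over conditions on all arcs.\<close>

definition flipped ::
  "'n commutator list \<Rightarrow> 'n \<Rightarrow> 'n \<Rightarrow> ('n::{finite,linorder} \<Rightarrow> 'n list) \<Rightarrow> ('n \<Rightarrow> 'n list) \<Rightarrow> bool" where
  "flipped N i j \<Lambda> \<Lambda>' \<longleftrightarrow> \<Lambda>' \<in> arr N \<and>
     (\<exists>c > 0. brick_vector N \<Lambda>' - brick_vector N \<Lambda> = c *\<^sub>R (axis j 1 - axis i 1)) \<and>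
     (\<forall>k l u. contact N (\<Lambda>' k) (\<Lambda>' l) u \<longrightarrow> {k, l} = {i, j} \<or> contact N (\<Lambda> k) (\<Lambda> l) u \<or>
        contact N (\<Lambda> (Transposition.transpose i j k)) (\<Lambda> (Transposition.transpose i j l)) u)"

lemma exists_flipped:
  assumes "network N" "\<Lambda> \<in> arr N" "contact N (\<Lambda> i) (\<Lambda> j) r"
  shows "\<exists>\<Lambda>'. flipped N i j \<Lambda> \<Lambda>'"
proof -
  have ij: "i \<noteq> j" using contact_less[OF assms(1,3)] by blast
  obtain c where c: "crossing N (\<Lambda> i) (\<Lambda> j) c"
    using assms(2) ij unfolding arr_def by blast
  have "c \<noteq> r" using c contact_not_crossing[OF assms(1,3)] by blast
  \<comment> \<open>The crossing may lie on either side of the contact.\<close>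
  define s t where "s = min c r" and "t = max c r"
  have st: "s < t" and cr: "contact N (\<Lambda> i) (\<Lambda> j) s \<and> crossing N (\<Lambda> i) (\<Lambda> j) t \<or>
      crossing N (\<Lambda> i) (\<Lambda> j) s \<and> contact N (\<Lambda> i) (\<Lambda> j) t"
    using c assms(3) \<open>c \<noteq> r\<close> by (auto simp: s_def t_def min_def max_def)
  have tm: "t < length N" using cr by (auto simp: crossing_def contact_def)
  have ms: "meets N (\<Lambda> i) (\<Lambda> j) s" "meets N (\<Lambda> i) (\<Lambda> j) t" 
    using cr unfolding arr_meets_iff[OF assms(2) ij] by blast+
  have F: "flip N i j s t \<Lambda> \<in> arr N"
    using flip_in_arr[OF assms(1,2) ij st ms] cr by blast
  have "flipped N i j \<Lambda> (flip N i j s t \<Lambda>)"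
    unfolding flipped_def
    using F brick_vector_flip[OF assms(1,2) st F cr] contact_flip[OF assms(2) ij st ms] by blast
  then show ?thesis by blast
qed

section \<open>Uniqueness of the arrangement sorted by a linear order\<close>

text \<open>So \<open>\<rho>\<close> is a topological numbering of the contact graph; an injective
  \<open>\<rho>\<close> encodes a linear order on the labels.\<close>

definition sorted_by :: "'n commutator list \<Rightarrow> ('n \<Rightarrow> nat) \<Rightarrow> ('n \<Rightarrow> 'n list) \<Rightarrow> bool" where
  "sorted_by N \<rho> \<Lambda> \<longleftrightarrow> (\<forall>i j t. contact N (\<Lambda> i) (\<Lambda> j) t \<longrightarrow> \<rho> i < \<rho> j)"

lemma arr_surj:
  assumes "\<Lambda> \<in> arr N" "t \<le> length N"
  obtains i where "\<Lambda> i ! t = x"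
proof -
  have "inj (\<lambda>i. \<Lambda> i ! t)" using arr_distinct[OF assms] by (simp add: inj_def)
  then have "surj (\<lambda>i. \<Lambda> i ! t)" by (rule finite_UNIV_inj_surj[OF finite])
  then obtain i where "x = \<Lambda> i ! t" by (rule surjE)
  then show thesis using that by simp
qed

lemma arr_eqI:
  assumes "\<Lambda> \<in> arr N" "\<Lambda>' \<in> arr N" "\<And>k t. t \<le> length N \<Longrightarrow> \<Lambda> k ! t = \<Lambda>' k ! t"
  shows "\<Lambda> = \<Lambda>'"
proof
  fix k
  have "length (\<Lambda> k) = Suc (length N)" "length (\<Lambda>' k) = Suc (length N)"
    using arr_pseudoline(1)[OF assms(1), of k] arr_pseudoline(1)[OF assms(2), of k]
    by (simp_all add: pseudoline_def)
  then show "\<Lambda> k = \<Lambda>' k" by (intro nth_equalityI) (simp_all add: assms(3))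
qed

text \<open>If \<open>i < j\<close>, then \<open>i\<close> above \<open>j\<close> means that they
  have already crossed, so they can only touch. If \<open>j < i\<close>, a contact would be an arc
  that decreases \<open>\<rho>\<close>, so they must cross.\<close>

lemma greedy_step:
  assumes "network N" "\<Lambda> \<in> arr N" "sorted_by N \<rho> \<Lambda>" "\<And>i j. i < j \<Longrightarrow> \<rho> i < \<rho> j"
    and "t < length N" "\<Lambda> i ! t = snd (N ! t)" "\<Lambda> j ! t = fst (N ! t)"
  shows "\<Lambda> k ! Suc t = (if i < j \<or> k \<notin> {i, j} then \<Lambda> k ! t else if k = i then fst (N ! t) else snd (N ! t))"
proof -
  obtain a b where ab: "N ! t = (a, b)" "a < b" using network_nth[OF assms(1,5)] by blast
  have ij: "i \<noteq> j" using assms(6,7) ab by auto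
  have meet: "meets N (\<Lambda> i) (\<Lambda> j) t" using assms(5-7) by (simp add: meets_def insert_commute)
  have nji: "\<not> contact N (\<Lambda> j) (\<Lambda> i) t" using assms(6,7) ab by (auto simp: contact_def)
  have cr: "crossing N (\<Lambda> i) (\<Lambda> j) t \<Longrightarrow> j < i"
    using crossing_order(2)[OF assms(1,2) ij, of t t] assms(5-7) ab by simp
  have ct: "contact N (\<Lambda> i) (\<Lambda> j) t \<Longrightarrow> i < j"
    using assms(3,4) unfolding sorted_by_def by (metis ij linorder_neqE less_asym)
  have step: "\<Lambda> k ! Suc t = \<Lambda> k ! t \<or> \<Lambda> k ! t = a \<and> \<Lambda> k ! Suc t = b \<or> \<Lambda> k ! t = b \<and> \<Lambda> k ! Suc t = a"
    using pseudoline_step[OF arr_pseudoline(1)[OF assms(2)] assms(5) ab(1)] .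
  show ?thesis
  proof (cases "k \<in> {i, j}")
    case False
    then have "\<Lambda> k ! t \<noteq> a" "\<Lambda> k ! t \<noteq> b"
      using arr_distinct[OF assms(2), of t k i] arr_distinct[OF assms(2), of t k j] assms(5-7) ab by auto
    then show ?thesis using step False by simp
  next
    case True
    show ?thesis
    proof (cases "i < j")
      case lt: True
      then have "contact N (\<Lambda> i) (\<Lambda> j) t"
        using meet nji cr unfolding arr_meets_iff[OF assms(2) ij] by (meson less_asym)
      then show ?thesis using lt True assms(6,7) by (auto simp: contact_def)
    next
      case nlt: False
      then have "crossing N (\<Lambda> i) (\<Lambda> j) t"
        using meet nji ct unfolding arr_meets_iff[OF assms(2) ij] by blast
      then have "{b, \<Lambda> i ! Suc t} = {a, b}" "{a, \<Lambda> j ! Suc t} = {a, b}"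
        using ab assms(6,7) by (simp_all add: crossing_def traverses_def)
      then have "\<Lambda> i ! Suc t = a" "\<Lambda> j ! Suc t = b" using ab(2) unfolding doubleton_eq_iff by auto
      then show ?thesis using nlt True ab(1) ij by auto
    qed
  qed
qed

lemma sorted_by_unique_mono:
  assumes "network N" "\<And>i j. i < j \<Longrightarrow> \<rho> i < \<rho> j"
    and "\<Lambda> \<in> arr N" "sorted_by N \<rho> \<Lambda>" "\<Lambda>' \<in> arr N" "sorted_by N \<rho> \<Lambda>'"
  shows "\<Lambda> = \<Lambda>'"
proof (rule arr_eqI[OF assms(3,5)])
  fix k t
  assume "t \<le> length N"
  then show "\<Lambda> k ! t = \<Lambda>' k ! t"
  proof (induction t arbitrary: k)
    case 0
    then show ?case using arr_pseudoline(2)[OF assms(3)] arr_pseudoline(2)[OF assms(5)] by simp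
  next
    case (Suc t)
    then have t: "t < length N" by simp
    obtain i j where ij: "\<Lambda> i ! t = snd (N ! t)" "\<Lambda> j ! t = fst (N ! t)"
      using arr_surj[OF assms(3), of t] t by (metis less_imp_le)
    have IH: "\<Lambda> l ! t = \<Lambda>' l ! t" for l using Suc.IH t by simp
    show ?case
      using greedy_step[OF assms(1,3,4,2) t ij, of k]
        greedy_step[OF assms(1,5,6,2) t ij[unfolded IH], of k] by (simp add: IH)
  qed
qed

lemma flip_flip:
  assumes "\<Lambda> \<in> arr N"
  shows "flip N i j s t (flip N i j s t \<Lambda>) = \<Lambda>"
proof
  fix k
  have "length (\<Lambda> k) = Suc (length N)" using arr_pseudoline(1)[OF assms] by (simp add: pseudoline_def)
  then show "flip N i j s t (flip N i j s t \<Lambda>) k = \<Lambda> k"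
    by (intro nth_equalityI) (simp_all add: flip_nth)
qed

lemma flip_trivial:
  assumes "\<Lambda> \<in> arr N"
  shows "flip N i j s s \<Lambda> = \<Lambda>"
proof
  fix k
  have "length (\<Lambda> k) = Suc (length N)" using arr_pseudoline(1)[OF assms] by (simp add: pseudoline_def)
  then show "flip N i j s s \<Lambda> k = \<Lambda> k"
    by (intro nth_equalityI) (auto simp: flip_nth)
qed

text \<open>As \<open>i\<close> and \<open>j\<close> have consecutive ranks among the labels, a
  third label compares in the same way with both.\<close>

lemma transpose_adjacent_less:
  fixes \<rho> :: "'a \<Rightarrow> nat"
  assumes "inj \<rho>" "\<And>k. \<not> (\<rho> i < \<rho> k \<and> \<rho> k < \<rho> j)" "{k, l} \<noteq> {i, j}" "\<rho> k < \<rho> l" "\<rho> i < \<rho> j"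
  shows "\<rho> (Transposition.transpose i j k) < \<rho> (Transposition.transpose i j l)"
proof -
  have "\<rho> x = \<rho> y \<longleftrightarrow> x = y" for x y using assms(1) by (simp add: inj_eq)
  then have "x \<noteq> j \<Longrightarrow> \<rho> i < \<rho> x \<Longrightarrow> \<rho> j < \<rho> x" "x \<noteq> i \<Longrightarrow> \<rho> x < \<rho> j \<Longrightarrow> \<rho> x < \<rho> i" for x
    using assms(2)[of x] by (metis linorder_neqE_nat)+
  then show ?thesis using assms(3-5) by (auto simp: Transposition.transpose_def)
qed

text \<open>Since the contacts of \<open>i\<close> and \<open>j\<close> all have the same direction, their crossing is their last
  meeting; flipping it with the first one reverses all these contacts, and a third label compares
  in the same way with \<open>i\<close> and with \<open>j\<close>, so that no other contact matters.\<close>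

lemma sorted_by_transpose:
  assumes "network N" "\<Lambda> \<in> arr N" "sorted_by N \<rho> \<Lambda>"
    and "inj \<rho>" "j < i" "\<rho> i < \<rho> j" "\<And>k. \<not> (\<rho> i < \<rho> k \<and> \<rho> k < \<rho> j)"
  defines "M \<equiv> {t. meets N (\<Lambda> i) (\<Lambda> j) t}"
  shows "flip N i j (Min M) (Max M) \<Lambda> \<in> arr N"
    and "sorted_by N (\<lambda>k. \<rho> (Transposition.transpose i j k)) (flip N i j (Min M) (Max M) \<Lambda>)"
proof -
  let ?F = "flip N i j (Min M) (Max M) \<Lambda>"
  have ij: "i \<noteq> j" using assms(5) by simp
  have "M \<subseteq> {..<length N}" by (auto simp: M_def meets_def)
  then have fin: "finite M" by (rule finite_subset) simp
  obtain c where c: "crossing N (\<Lambda> i) (\<Lambda> j) c" using assms(2) ij unfolding arr_def by blast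
  have cM: "c \<in> M" using c by (simp add: M_def arr_meets_iff[OF assms(2) ij])
  have nji: "\<not> contact N (\<Lambda> j) (\<Lambda> i) t" for t
    using assms(3,6) unfolding sorted_by_def by (meson less_asym)
  have uniq: "t = c" if "crossing N (\<Lambda> i) (\<Lambda> j) t" for t
    using that c assms(2) ij unfolding arr_def by blast
  have M_cases: "t = c \<or> contact N (\<Lambda> i) (\<Lambda> j) t" if "t \<in> M" for t
    using that nji uniq by (auto simp: M_def arr_meets_iff[OF assms(2) ij])
  \<comment> \<open>Since \<open>j < i\<close>, the path \<open>i\<close> is above \<open>j\<close>
    only up to their crossing, so their contacts precede it.\<close>
  have "t \<le> c" if t: "t \<in> M" for t
  proof (cases "t = c")
    case False
    then have ct: "contact N (\<Lambda> i) (\<Lambda> j) t" using M_cases[OF t] by simp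
    then show ?thesis
      using crossing_order(2)[OF assms(1,2) ij c, of t] contact_less[OF assms(1) ct] assms(5) by simp
  qed simp
  then have Max: "Max M = c" using fin cM by (intro Max_eqI) auto
  have min: "Min M \<in> M" using fin cM by (intro Min_in) auto
  have le: "Min M \<le> t" if "t \<in> M" for t using fin that by simp
  have adj: "\<rho> (Transposition.transpose i j k) < \<rho> (Transposition.transpose i j l)"
    if "{k, l} \<noteq> {i, j}" "\<rho> k < \<rho> l" for k l
    using transpose_adjacent_less[OF assms(4,7) that assms(6)] .
  have "?F \<in> arr N \<and> sorted_by N (\<lambda>k. \<rho> (Transposition.transpose i j k)) ?F"
  proof (cases "Min M = c")
    \<comment> \<open>The crossing is the only meeting: the zone is empty, the flip is the identity,
      and no contact compares \<open>i\<close> with \<open>j\<close>.\<close>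
    case True
    have M: "t = c" if "t \<in> M" for t using le[OF that] \<open>\<And>t. t \<in> M \<Longrightarrow> t \<le> c\<close>[OF that] True by simp
    have "\<rho> (Transposition.transpose i j k) < \<rho> (Transposition.transpose i j l)"
      if ct: "contact N (\<Lambda> k) (\<Lambda> l) t" for k l t
    proof (rule adj)
      show "\<rho> k < \<rho> l" using ct assms(3) unfolding sorted_by_def by blast
      show "{k, l} \<noteq> {i, j}"
      proof
        assume "{k, l} = {i, j}"
        then have *: "contact N (\<Lambda> i) (\<Lambda> j) t" using ct nji by (auto simp: doubleton_eq_iff)
        then have "t = c" using M by (simp add: M_def arr_meets_iff[OF assms(2) ij])
        then show False using c contact_not_crossing[OF assms(1) *] by blast
      qed
    qed
    then show ?thesis
      unfolding Max True flip_trivial[OF assms(2)] sorted_by_def using assms(2) by blast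
  next
    case False
    then have st: "Min M < c" using le[OF cM] by simp
    have ct: "contact N (\<Lambda> i) (\<Lambda> j) (Min M)" using M_cases[OF min] False by simp
    have m: "meets N (\<Lambda> i) (\<Lambda> j) (Min M)" "meets N (\<Lambda> i) (\<Lambda> j) c" using min cM by (simp_all add: M_def)
    have F: "?F \<in> arr N" unfolding Max using flip_in_arr[OF assms(1,2) ij st m] c by blast
    \<comment> \<open>The crossing now sits at \<open>Min M\<close>, so all the other meetings come
      after it, with \<open>j\<close> above \<open>i\<close>: these contacts are arcs from
      \<open>j\<close> to \<open>i\<close>, as the exchanged ranks require.\<close>
    have cF: "crossing N (?F i) (?F j) (Min M)"
      unfolding arr_crossing[OF assms(1) F ij]
      unfolding Max using ordered_until_flip_pair(2)[OF assms(1,2) ij st _ c] c by (simp add: crossing_def)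
    have "\<rho> (Transposition.transpose i j k) < \<rho> (Transposition.transpose i j l)"
      if F_ct: "contact N (?F k) (?F l) t" for k l t
    proof (cases "{k, l} = {i, j}")
      case True
      then have "meets N (?F i) (?F j) t"
        using contact_meets[OF F_ct] by (auto simp: doubleton_eq_iff meets_commute)
      then have "t \<in> M" unfolding meets_flip[OF ij] by (simp add: M_def)
      moreover have "t \<noteq> Min M"
      proof
        assume "t = Min M"
        then have "crossing N (?F k) (?F l) t"
          using cF True by (auto simp: doubleton_eq_iff crossing_commute)
        then show False using contact_not_crossing[OF assms(1) F_ct] by blast
      qed
      ultimately have "Min M < t" using le[of t] by simp
      then have "\<not> ?F j ! t < ?F i ! t"
        using crossing_order(2)[OF assms(1) F ij cF, of t] contact_less(3)[OF assms(1) F_ct] assms(5) by simp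
      then have "k = j" "l = i"
        using contact_less(1)[OF assms(1) F_ct] True by (auto simp: doubleton_eq_iff)
      then show ?thesis using assms(6) by simp
    next
      case False
      then consider "contact N (\<Lambda> k) (\<Lambda> l) t" |
        "contact N (\<Lambda> (Transposition.transpose i j k)) (\<Lambda> (Transposition.transpose i j l)) t"
        using contact_flip[OF assms(2) ij st m F_ct[unfolded Max]] by blast
      then show ?thesis
      proof cases
        case 1
        then have "\<rho> k < \<rho> l" using assms(3) unfolding sorted_by_def by blast
        then show ?thesis using adj False by blast
      next
        case 2
        then show ?thesis using assms(3) unfolding sorted_by_def by blast
      qed
    qed
    then show ?thesis using F unfolding sorted_by_def by blast
  qed
  then show "?F \<in> arr N" "sorted_by N (\<lambda>k. \<rho> (Transposition.transpose i j k)) ?F" by blast+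
qed

text \<open>In an inversion with the smallest gap of ranks, a label ranked strictly between would
  form an inversion of smaller gap with one of the two.\<close>

lemma exists_adjacent_inversion:
  fixes \<rho> :: "'n::{finite,linorder} \<Rightarrow> nat"
  assumes "inj \<rho>" "i0 < j0" "\<not> \<rho> i0 < \<rho> j0"
  obtains i j where "j < i" "\<rho> i < \<rho> j" "\<And>k. \<not> (\<rho> i < \<rho> k \<and> \<rho> k < \<rho> j)"
proof -
  define P where "P = (\<lambda>d. \<exists>i j. j < i \<and> \<rho> i < \<rho> j \<and> \<rho> j - \<rho> i = d)"
  have "\<rho> j0 < \<rho> i0" using assms by (metis injD less_irrefl linorder_neqE_nat)
  then have "P (\<rho> i0 - \<rho> j0)" using assms(2) unfolding P_def by blast
  then obtain d where "P d" and min: "\<And>e. e < d \<Longrightarrow> \<not> P e" using exists_least_iff[of P] by blast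
  then obtain i j where ij: "j < i" "\<rho> i < \<rho> j" "\<rho> j - \<rho> i = d" unfolding P_def by blast
  have "\<not> (\<rho> i < \<rho> k \<and> \<rho> k < \<rho> j)" for k
  proof
    assume k: "\<rho> i < \<rho> k \<and> \<rho> k < \<rho> j"
    then consider "j < k" | "k < j" by (metis less_irrefl linorder_neqE)
    then show False
    proof cases
      case 1
      then have "P (\<rho> j - \<rho> k)" using k unfolding P_def by blast
      moreover have "\<rho> j - \<rho> k < d" using k ij(3) by linarith
      ultimately show False using min by blast
    next
      case 2
      then have "k < i" using ij(1) by simp
      then have "P (\<rho> k - \<rho> i)" using k unfolding P_def by blast
      moreover have "\<rho> k - \<rho> i < d" using k ij(3) by linarith
      ultimately show False using min by blast
    qed
  qed
  then show thesis using that ij(1,2) by blast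
qed

text \<open>Induction on the number of inversions of \<open>\<rho>\<close>: exchanging the ranks of
  an adjacent inverted pair lowers it, and flips transport arrangements sorted by
  \<open>\<rho>\<close> injectively to arrangements sorted by the new ranks. Without inversions the
  greedy construction applies.\<close>

lemma sorted_by_unique:
  fixes N :: "('n::{finite,linorder}) commutator list"
  assumes "network N" "inj \<rho>"
    and "\<Lambda> \<in> arr N" "sorted_by N \<rho> \<Lambda>" "\<Lambda>' \<in> arr N" "sorted_by N \<rho> \<Lambda>'"
  shows "\<Lambda> = \<Lambda>'"
  using assms(2-6)
proof (induction "card {(i, j). j < i \<and> \<rho> i < \<rho> j}" arbitrary: \<rho> \<Lambda> \<Lambda>' rule: less_induct)
  case less
  show ?case
  proof (cases "\<forall>i j. i < j \<longrightarrow> \<rho> i < \<rho> j")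
    case True
    then show ?thesis using sorted_by_unique_mono[OF assms(1) _ less.prems(2-5)] by blast
  next
    case False
    then obtain i j where ij: "j < i" "\<rho> i < \<rho> j" "\<And>k. \<not> (\<rho> i < \<rho> k \<and> \<rho> k < \<rho> j)"
      using exists_adjacent_inversion[OF less.prems(1)] by metis
    define \<rho>' where "\<rho>' = (\<lambda>k. \<rho> (Transposition.transpose i j k))"
    have inj': "inj \<rho>'"
      using less.prems(1) unfolding \<rho>'_def inj_def by (meson transpose_eq_imp_eq)
    have less_iff: "\<rho>' k < \<rho>' l \<Longrightarrow> \<rho> k < \<rho> l" if "{k, l} \<noteq> {i, j}" for k l
    proof (rule ccontr)
      assume *: "\<rho>' k < \<rho>' l" "\<not> \<rho> k < \<rho> l"
      then have "\<rho> l < \<rho> k" using less.prems(1) by (metis injD less_irrefl linorder_neqE_nat)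
      then have "\<rho>' l < \<rho>' k"
        unfolding \<rho>'_def
        using transpose_adjacent_less[OF less.prems(1) ij(3) _ _ ij(2), of l k] that
        by (simp add: insert_commute)
      then show False using *(1) by simp
    qed
    have "{(k, l). l < k \<and> \<rho>' k < \<rho>' l} \<subset> {(k, l). l < k \<and> \<rho> k < \<rho> l}"
    proof
      show "{(k, l). l < k \<and> \<rho>' k < \<rho>' l} \<subseteq> {(k, l). l < k \<and> \<rho> k < \<rho> l}"
      proof clarify
        fix k l assume kl: "l < k" "\<rho>' k < \<rho>' l"
        show "\<rho> k < \<rho> l"
        proof (cases "{k, l} = {i, j}")
          case True
          then have "k = i" "l = j" using kl(1) ij(1) by (auto simp: doubleton_eq_iff)
          then show ?thesis using ij(2) by simp
        next
          case False then show ?thesis using less_iff kl(2) by blast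
        qed
      qed
      have "(i, j) \<in> {(k, l). l < k \<and> \<rho> k < \<rho> l}" using ij by simp
      moreover have "(i, j) \<notin> {(k, l). l < k \<and> \<rho>' k < \<rho>' l}" using ij by (simp add: \<rho>'_def)
      ultimately show "{(k, l). l < k \<and> \<rho>' k < \<rho>' l} \<noteq> {(k, l). l < k \<and> \<rho> k < \<rho> l}" by blast
    qed
    then have card: "card {(k, l). l < k \<and> \<rho>' k < \<rho>' l} < card {(k, l). l < k \<and> \<rho> k < \<rho> l}"
      by (intro psubset_card_mono) auto
    \<comment> \<open>\<open>F\<close> recomputes its two positions from its argument. As it
      preserves the set of meetings, a second application uses the same positions and undoes the
      first.\<close>
    define M where "M X = {t. meets N (X i) (X j) t}" for X
    define F where "F X = flip N i j (Min (M X)) (Max (M X)) X" for X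
    have F: "F X \<in> arr N" "sorted_by N \<rho>' (F X)" "F (F X) = X"
      if X: "X \<in> arr N" "sorted_by N \<rho> X" for X
    proof -
      show "F X \<in> arr N" "sorted_by N \<rho>' (F X)"
        using sorted_by_transpose[OF assms(1) X less.prems(1) ij] unfolding F_def M_def \<rho>'_def by blast+
      have "i \<noteq> j" using ij(1) by simp
      then have "t \<in> M (F X) \<longleftrightarrow> t \<in> M X" for t
        unfolding M_def F_def mem_Collect_eq by (rule meets_flip)
      then have "M (F X) = M X" by blast
      then have "F (F X) = flip N i j (Min (M X)) (Max (M X)) (F X)" unfolding F_def[of "F X"] by simp
      also have "\<dots> = X" unfolding F_def by (rule flip_flip[OF X(1)])
      finally show "F (F X) = X" .
    qed
    have "F \<Lambda> = F \<Lambda>'"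
      by (rule less.hyps[OF card inj' F(1,2)[OF less.prems(2,3)] F(1,2)[OF less.prems(4,5)]])
    then show ?thesis using F(3)[OF less.prems(2,3)] F(3)[OF less.prems(4,5)] by metis
  qed
qed

section \<open>Linear functionals minimal at a given arrangement\<close>

lemma finite_arr: "finite (arr (N :: ('n::{finite,linorder}) commutator list))"
proof (rule finite_subset)
  let ?L = "{p :: 'n list. set p \<subseteq> UNIV \<and> length p = Suc (length N)}"
  show "arr N \<subseteq> (UNIV :: 'n set) \<rightarrow>\<^sub>E ?L"
    using arr_pseudoline(1) by (auto simp: pseudoline_def)
  show "finite ((UNIV :: 'n set) \<rightarrow>\<^sub>E ?L)"
    by (intro finite_PiE finite_lists_length_eq) auto
qed

lemma flipped_inner:
  fixes a :: "real ^ 'n::{finite,linorder}"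
  assumes "flipped N i j \<Lambda> \<Lambda>'"
  shows "a $ i = a $ j \<Longrightarrow> a \<bullet> brick_vector N \<Lambda>' = a \<bullet> brick_vector N \<Lambda>"
    and "a $ j < a $ i \<Longrightarrow> a \<bullet> brick_vector N \<Lambda>' < a \<bullet> brick_vector N \<Lambda>"
proof -
  obtain c where c: "c > 0" "brick_vector N \<Lambda>' - brick_vector N \<Lambda> = c *\<^sub>R (axis j 1 - axis i 1)"
    using assms unfolding flipped_def by blast
  have "a \<bullet> brick_vector N \<Lambda>' - a \<bullet> brick_vector N \<Lambda> = a \<bullet> (c *\<^sub>R (axis j 1 - axis i 1))"
    unfolding c(2)[symmetric] by (rule inner_diff_right[symmetric])
  also have "\<dots> = c * (a $ j - a $ i)" by (simp add: inner_diff_right inner_axis)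
  finally have eq: "a \<bullet> brick_vector N \<Lambda>' - a \<bullet> brick_vector N \<Lambda> = c * (a $ j - a $ i)" .
  show "a \<bullet> brick_vector N \<Lambda>' = a \<bullet> brick_vector N \<Lambda>" if "a $ i = a $ j"
    using eq that by simp
  show "a \<bullet> brick_vector N \<Lambda>' < a \<bullet> brick_vector N \<Lambda>" if "a $ j < a $ i"
    using eq that c(1) by (smt (verit) mult_pos_neg)
qed

definition lex_less :: "real ^ ('n::{finite,linorder}) \<Rightarrow> 'n \<Rightarrow> 'n \<Rightarrow> bool" where
  "lex_less a i j \<longleftrightarrow> a $ i < a $ j \<or> a $ i = a $ j \<and> i < j"

definition lex_rank :: "real ^ ('n::{finite,linorder}) \<Rightarrow> 'n \<Rightarrow> nat" where
  "lex_rank a i = card {k. lex_less a k i}"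

lemma lex_rank_mono:
  assumes "lex_less a i j"
  shows "lex_rank a i < lex_rank a j"
  unfolding lex_rank_def
proof (rule psubset_card_mono)
  have "i \<in> {k. lex_less a k j}" "i \<notin> {k. lex_less a k i}" using assms by (auto simp: lex_less_def)
  moreover have "{k. lex_less a k i} \<subseteq> {k. lex_less a k j}" using assms by (auto simp: lex_less_def)
  ultimately show "{k. lex_less a k i} \<subset> {k. lex_less a k j}" by blast
qed simp

lemma inj_lex_rank: "inj (lex_rank a)"
proof (rule injI, rule ccontr)
  fix i j assume "lex_rank a i = lex_rank a j" "i \<noteq> j"
  moreover have "lex_less a i j \<or> lex_less a j i" using \<open>i \<noteq> j\<close> by (auto simp: lex_less_def)
  ultimately show False using lex_rank_mono[of a i j] lex_rank_mono[of a j i] by auto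
qed

text \<open>Ties are broken by minimising over \<open>S\<close> a second functional \<open>g\<close>
  that strictly increases with the label: a contact of \<open>i\<close> above \<open>j\<close> with
  equal values of \<open>a\<close> and \<open>j < i\<close> could be flipped within
  \<open>S\<close>, which would lower \<open>g\<close>.\<close>

lemma exists_sorted_by_lex_rank:
  fixes N :: "('n::{finite,linorder}) commutator list"
  assumes "network N" "S \<subseteq> arr N" "S \<noteq> {}"
    and le: "\<And>X i j t. X \<in> S \<Longrightarrow> contact N (X i) (X j) t \<Longrightarrow> a $ i \<le> a $ j"
    and closed: "\<And>X Y i j. X \<in> S \<Longrightarrow> flipped N i j X Y \<Longrightarrow> a $ i = a $ j \<Longrightarrow> Y \<in> S"
  shows "\<exists>X \<in> S. sorted_by N (lex_rank a) X"
proof -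
  define g :: "(real, 'n) vec" where "g = (\<chi> k. real (card {..<k}))"
  have g: "g $ j < g $ i" if "j < i" for i j
  proof -
    have "{..<j} \<subset> {..<i}" using that by (simp add: lessThan_strict_subset_iff)
    then have "card {..<j} < card {..<i}" by (intro psubset_card_mono) simp_all
    then show ?thesis by (simp add: g_def)
  qed
  have fin: "finite S" using assms(2) finite_arr by (rule finite_subset)
  define X where "X = arg_min_on (\<lambda>X. g \<bullet> brick_vector N X) S"
  have X: "X \<in> S" and min: "\<And>Y. Y \<in> S \<Longrightarrow> \<not> g \<bullet> brick_vector N Y < g \<bullet> brick_vector N X"
    using arg_min_if_finite[OF fin assms(3), of "\<lambda>X. g \<bullet> brick_vector N X"] unfolding X_def by simp_all
  have "lex_less a i j" if ct: "contact N (X i) (X j) t" for i j t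
  proof (rule ccontr)
    assume "\<not> lex_less a i j"
    moreover have "i \<noteq> j" using contact_less(1)[OF assms(1) ct] by blast
    ultimately have eq: "a $ i = a $ j" "j < i" using le[OF X ct] by (auto simp: lex_less_def)
    obtain Y where Y: "flipped N i j X Y" using exists_flipped[OF assms(1) _ ct] X assms(2) by blast
    then show False using min[OF closed[OF X Y eq(1)]] flipped_inner(2)[OF Y g[OF eq(2)]] by blast
  qed
  then have "sorted_by N (lex_rank a) X" unfolding sorted_by_def using lex_rank_mono by blast
  then show ?thesis using X by blast
qed

text \<open>Both the arrangements that minimise \<open>a\<close> and those that cannot be distinguished from \<open>\<Lambda>\<close>
  by \<open>a\<close> contain an arrangement sorted by \<open>a\<close> with ties broken, and there is only one.\<close>

lemma brick_vector_minimal: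
  fixes N :: "('n::{finite,linorder}) commutator list"
  assumes "network N" "\<Lambda> \<in> arr N" "\<Lambda>' \<in> arr N"
    and "\<And>i j t. contact N (\<Lambda> i) (\<Lambda> j) t \<Longrightarrow> a $ i \<le> a $ j"
  shows "a \<bullet> brick_vector N \<Lambda> \<le> a \<bullet> brick_vector N \<Lambda>'"
proof -
  let ?v = "\<lambda>X. a \<bullet> brick_vector N X"
  define S where "S = {X \<in> arr N. (\<forall>i j t. contact N (X i) (X j) t \<longrightarrow> a $ i \<le> a $ j) \<and> ?v X = ?v \<Lambda>}"
  have "\<exists>X \<in> S. sorted_by N (lex_rank a) X"
  proof (rule exists_sorted_by_lex_rank[OF assms(1)])
    show "S \<subseteq> arr N" unfolding S_def by blast
    have "\<Lambda> \<in> S" unfolding S_def using assms(2,4) by blast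
    then show "S \<noteq> {}" by blast
    show "a $ i \<le> a $ j" if "X \<in> S" "contact N (X i) (X j) t" for X i j t
      using that unfolding S_def by blast
    show "Y \<in> S" if X: "X \<in> S" and Y: "flipped N i j X Y" and eq: "a $ i = a $ j" for X Y i j
    proof -
      \<comment> \<open>As \<open>a\<close> takes the same value at \<open>i\<close> and
        \<open>j\<close>, it is invariant under their exchange, so the exchanged contacts satisfy
        the inequality too.\<close>
      have \<sigma>: "a $ Transposition.transpose i j k = a $ k" for k
        using eq by (simp add: Transposition.transpose_def)
      have "a $ k \<le> a $ l" if ct: "contact N (Y k) (Y l) t" for k l t
      proof -
        consider "{k, l} = {i, j}" | "contact N (X k) (X l) t" |
          "contact N (X (Transposition.transpose i j k)) (X (Transposition.transpose i j l)) t"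
          using Y ct unfolding flipped_def by blast
        then show ?thesis
        proof cases
          case 1 then show ?thesis using eq by (auto simp: doubleton_eq_iff)
        next
          case 2 then show ?thesis using X unfolding S_def by blast
        next
          case 3
          then have "a $ Transposition.transpose i j k \<le> a $ Transposition.transpose i j l"
            using X unfolding S_def by blast
          then show ?thesis unfolding \<sigma> .
        qed
      qed
      moreover have "Y \<in> arr N" using Y unfolding flipped_def by blast
      moreover have "?v Y = ?v \<Lambda>" using flipped_inner(1)[OF Y eq] X unfolding S_def by simp
      ultimately show ?thesis unfolding S_def by blast
    qed
  qed
  then obtain X where X: "X \<in> S" "sorted_by N (lex_rank a) X" by blast
  define T where "T = {X \<in> arr N. \<forall>Y \<in> arr N. ?v X \<le> ?v Y}"
  have "\<exists>X \<in> T. sorted_by N (lex_rank a) X"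
  proof (rule exists_sorted_by_lex_rank[OF assms(1)])
    show "T \<subseteq> arr N" unfolding T_def by blast
    have "arr N \<noteq> {}" using assms(2) by blast
    from arg_min_if_finite[OF finite_arr this, of ?v]
    have "arg_min_on ?v (arr N) \<in> T" unfolding T_def by (simp add: not_less)
    then show "T \<noteq> {}" by blast
    \<comment> \<open>Flipping a contact that violates the inequality would lower the
      minimum.\<close>
    show "a $ i \<le> a $ j" if X: "X \<in> T" and ct: "contact N (X i) (X j) t" for X i j t
    proof (rule ccontr)
      assume "\<not> a $ i \<le> a $ j"
      then have lt: "a $ j < a $ i" by simp
      obtain Y where Y: "flipped N i j X Y" using exists_flipped[OF assms(1) _ ct] X unfolding T_def by blast
      then have "?v X \<le> ?v Y" using X unfolding T_def flipped_def by blast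
      then show False using flipped_inner(2)[OF Y lt] by simp
    qed
    show "Y \<in> T" if X: "X \<in> T" and Y: "flipped N i j X Y" and eq: "a $ i = a $ j" for X Y i j
      using X Y flipped_inner(1)[OF Y eq] unfolding T_def flipped_def by simp
  qed
  then obtain Z where Z: "Z \<in> T" "sorted_by N (lex_rank a) Z" by blast
  \<comment> \<open>\<open>X\<close> has the value of \<open>\<Lambda>\<close> and \<open>Z\<close>
    the minimal value; uniqueness identifies the two.\<close>
  have "X = Z"
    using sorted_by_unique[OF assms(1) inj_lex_rank _ X(2) _ Z(2)] X(1) Z(1) unfolding S_def T_def by blast
  then show ?thesis using X(1) Z(1) assms(3) unfolding S_def T_def by auto
qed

section \<open>Comparison of the cones\<close>

lemma incidence_cone_contact_graph:
  "incidence_cone (contact_graph N \<Lambda>) =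
    convex_cone hull {axis j 1 - axis i 1 | i j. \<exists>t. contact N (\<Lambda> i) (\<Lambda> j) t}"
proof -
  have "{axis (head (contact_graph N \<Lambda>) e) (1::real) - axis (tail (contact_graph N \<Lambda>) e) 1 | e.
      e \<in> arcs (contact_graph N \<Lambda>)} = {axis j 1 - axis i 1 | i j. \<exists>t. contact N (\<Lambda> i) (\<Lambda> j) t}"
    by (fastforce simp: contact_graph_def)
  then show ?thesis unfolding incidence_cone_def by simp
qed

text \<open>Farkas' lemma. A finitely generated cone is closed, so a point outside is strictly
  separated from it, and the bound \<open>b\<close> is negative because the cone contains 0.\<close>

lemma in_convex_cone_hullI:
  fixes S :: "'a::euclidean_space set"
  assumes "finite S" "\<And>a. (\<And>x. x \<in> S \<Longrightarrow> 0 \<le> a \<bullet> x) \<Longrightarrow> 0 \<le> a \<bullet> z"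
  shows "z \<in> convex_cone hull S"
proof (rule ccontr)
  assume "z \<notin> convex_cone hull S"
  then obtain a b where ab: "a \<bullet> z < b" "\<And>x. x \<in> convex_cone hull S \<Longrightarrow> b < a \<bullet> x"
    using separating_hyperplane_closed_point[OF convex_convex_cone_hull closed_convex_cone_hull[OF assms(1)]]
    by blast
  have b: "b < 0" using ab(2)[OF convex_cone_hull_contains_0] by simp
  have "0 \<le> a \<bullet> x" if "x \<in> S" for x
  proof (rule ccontr)
    assume "\<not> 0 \<le> a \<bullet> x"
    then have neg: "a \<bullet> x < 0" by simp
    \<comment> \<open>This multiple of the generator has inner product exactly \<open>b\<close> with
      \<open>a\<close>, against strict separation.\<close>
    then have "(b / (a \<bullet> x)) *\<^sub>R x \<in> convex_cone hull S"
      using b that by (intro convex_cone_hull_mul hull_inc) (auto simp: divide_nonpos_neg)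
    from ab(2)[OF this] show False using neg by simp
  qed
  from assms(2)[OF this] show False using ab(1) b by simp
qed

theorem theorem3p13:
  fixes N :: "('n::{finite,linorder}) commutator list"
    and \<Lambda> :: "'n \<Rightarrow> 'n list"
  assumes "network N" and "sorting N" and "irreducible_network N"
    and "\<Lambda> \<in> arr N"
  shows "cone_at (brick_polytope N) (brick_vector N \<Lambda>) = incidence_cone (contact_graph N \<Lambda>)
    \<and> convex_cone hull {brick_vector N \<Lambda>' - brick_vector N \<Lambda> | \<Lambda>'. \<Lambda>' \<in> arr N}
        = incidence_cone (contact_graph N \<Lambda>)"
proof -
  let ?w = "brick_vector N \<Lambda>"
  let ?E = "{axis j 1 - axis i 1 | i j. \<exists>t. contact N (\<Lambda> i) (\<Lambda> j) t} :: (real, 'n) vec set"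
  let ?C = "convex_cone hull ?E"
  let ?B = "convex_cone hull {brick_vector N \<Lambda>' - ?w | \<Lambda>'. \<Lambda>' \<in> arr N}"
  let ?P = "cone_at (brick_polytope N) ?w"
  have "?E \<subseteq> (\<lambda>(i, j). axis j 1 - axis i 1) ` UNIV" by auto
  then have fin: "finite ?E" by (rule finite_subset) simp
  have in_C: "brick_vector N \<Lambda>' - ?w \<in> ?C" if \<Lambda>': "\<Lambda>' \<in> arr N" for \<Lambda>'
  proof (rule in_convex_cone_hullI[OF fin])
    fix a :: "(real, 'n) vec"
    assume a: "\<And>x. x \<in> ?E \<Longrightarrow> 0 \<le> a \<bullet> x"
    have "a $ i \<le> a $ j" if "contact N (\<Lambda> i) (\<Lambda> j) t" for i j t
    proof -
      have "axis j 1 - axis i 1 \<in> ?E" using that by blast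
      from a[OF this] show ?thesis by (simp add: inner_diff_right inner_axis)
    qed
    from brick_vector_minimal[OF assms(1,4) \<Lambda>' this]
    show "0 \<le> a \<bullet> (brick_vector N \<Lambda>' - ?w)" by (simp add: inner_diff_right)
  qed
  \<comment> \<open>The three cones are compared cyclically: \<open>?P\<close> lies in
    \<open>?C\<close>, \<open>?B\<close> in \<open>?P\<close>, and \<open>?C\<close> in
    \<open>?B\<close>.\<close>
  have "?P \<subseteq> ?C"
    unfolding cone_at_def
  proof (rule hull_minimal)
    \<comment> \<open>The translate of \<open>?C\<close> with apex at the brick vector is convex, so
      it contains the polytope once it contains its generating points.\<close>
    have "brick_polytope N \<subseteq> (\<lambda>x. ?w + x) ` ?C"
      unfolding brick_polytope_def
    proof (rule hull_minimal)
      show "brick_vector N ` arr N \<subseteq> (\<lambda>x. ?w + x) ` ?C"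
      proof clarify
        fix \<Lambda>' assume "\<Lambda>' \<in> arr N"
        then show "brick_vector N \<Lambda>' \<in> (\<lambda>x. ?w + x) ` ?C"
          by (intro image_eqI[OF _ in_C]) simp
      qed
      show "convex ((\<lambda>x. ?w + x) ` ?C)"
        by (intro convex_translation convex_convex_cone_hull)
    qed
    then show "{x - ?w | x. x \<in> brick_polytope N} \<subseteq> ?C" by auto
    show "convex_cone ?C" by (rule convex_cone_convex_cone_hull)
  qed
  moreover have "?B \<subseteq> ?P"
    unfolding cone_at_def brick_polytope_def
  proof (rule hull_mono, clarify)
    fix \<Lambda>' assume "\<Lambda>' \<in> arr N"
    then have "brick_vector N \<Lambda>' \<in> convex hull (brick_vector N ` arr N)" by (intro hull_inc imageI)
    then show "\<exists>x. brick_vector N \<Lambda>' - ?w = x - ?w \<and> x \<in> convex hull (brick_vector N ` arr N)"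
      by blast
  qed
  moreover have "?C \<subseteq> ?B"
  proof (rule hull_minimal)
    show "?E \<subseteq> ?B"
    \<comment> \<open>Each arc is flipped once, and the resulting difference of brick vectors is
      rescaled by \<open>inverse c\<close>.\<close>
    proof clarify
      fix i j t assume "contact N (\<Lambda> i) (\<Lambda> j) t"
      then obtain \<Lambda>' where "flipped N i j \<Lambda> \<Lambda>'" using exists_flipped[OF assms(1,4)] by blast
      then obtain c where \<Lambda>': "\<Lambda>' \<in> arr N" "c > 0" "brick_vector N \<Lambda>' - ?w = c *\<^sub>R (axis j 1 - axis i 1)"
        unfolding flipped_def by blast
      have "brick_vector N \<Lambda>' - ?w \<in> ?B" using \<Lambda>'(1) by (intro hull_inc) blast
      then have "inverse c *\<^sub>R (brick_vector N \<Lambda>' - ?w) \<in> ?B"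
        using \<Lambda>'(2) by (intro convex_cone_hull_mul) simp_all
      then show "axis j 1 - axis i 1 \<in> ?B" using \<Lambda>'(2) unfolding \<Lambda>'(3) by simp
    qed
    show "convex_cone ?B" by (rule convex_cone_convex_cone_hull)
  qed
  ultimately show ?thesis unfolding incidence_cone_contact_graph by blast
qed

end
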